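(* Let $\Bbbk$ be an algebraically closed field of characteristic $p>2$ and let $m>0$. The second Kac–Weisfeiler conjecture holds for $(\mathfrak{sl}_2)_m=\mathfrak{sl}_2(\Bbbk)\otimes\Bbbk[t]/(t^{m+1})$: writing $\mathfrak l=(\mathfrak{sl}_2)_m$, for every $\chi\in\mathfrak l^*$ and every simple $U_\chi(\mathfrak l)$-module $M$, $p^{\frac12(\dim\mathfrak l-\dim\mathfrak l^\chi)}$ divides $\dim M$.
   Context: $\mathfrak l=\mathfrak{sl}_2(\Bbbk)\otimes\Bbbk[t]/(t^{m+1})$ is a Lie algebra over $\Bbbk$ with bracket $[xt^i,yt^j]=[x,y]t^{i+j}$ ($xt^i:=x\otimes t^i$), restricted with $p$-map determined by $(xt^i)^{[p]}=x^{[p]}t^{pi}$, where $x^{[p]}$ is the $p$-th matrix power. For $\chi\in\mathfrak l^*$, $\mathfrak l^\chi=\{x\in\mathfrak l\mid\chi([x,\mathfrak l])=0\}$, and $U_\chi(\mathfrak l)$ is the quotient of $U(\mathfrak l)$ by the ideal generated by $x^p-x^{[p]}-\chi(x)^p$, $x\in\mathfrak l$. *)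

theory Defs
  imports
    "HOL-Analysis.Determinants"
    "HOL-Algebra.QuotRing"
    "HOL-Computational_Algebra.Polynomial"
begin

section \<open>Free associative algebras\<close>

text \<open>
  The free associative algebra \<open>k\<langle>X\<rangle>\<close> on a set \<open>X\<close>: finitely supported functions on
  the words over \<open>X\<close>, multiplied by convolution along concatenation of words.
\<close>

definition free_alg :: "'l set \<Rightarrow> ('l list \<Rightarrow> 'k::field) ring" where
  "free_alg X =
    \<lparr>carrier = {f. finite {w. f w \<noteq> 0} \<and> {w. f w \<noteq> 0} \<subseteq> lists X},
     mult = (\<lambda>f g w. \<Sum>i\<le>length w. f (take i w) * g (drop i w)),
     one = (\<lambda>w. if w = [] then 1 else 0),
     zero = (\<lambda>w. 0),
     add = (\<lambda>f g w. f w + g w)\<rparr>"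

definition free_gen :: "'l \<Rightarrow> 'l list \<Rightarrow> 'k::field" where
  "free_gen x = (\<lambda>w. if w = [x] then 1 else 0)"

definition free_const :: "'k \<Rightarrow> 'l list \<Rightarrow> 'k::field" where
  "free_const c = (\<lambda>w. if w = [] then c else 0)"

section \<open>Enveloping algebras\<close>

text \<open>
  Throughout, a Lie algebra over \<open>'k\<close> is given by its carrier \<open>L\<close>, a subspace of an ambient
  vector space with scalar multiplication \<open>s\<close>, and its bracket \<open>br\<close>.
  The first two families of relations cut the free algebra on the set \<open>L\<close> down to the tensor
  algebra of the vector space \<open>L\<close>; the third one makes it the universal enveloping algebra.
\<close>

definition env_rels ::
  "('k::field \<Rightarrow> 'l::ab_group_add \<Rightarrow> 'l) \<Rightarrow> ('l \<Rightarrow> 'l \<Rightarrow> 'l) \<Rightarrow> 'l set \<Rightarrow> ('l list \<Rightarrow> 'k) set" where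
  "env_rels s br L =
    (let F = free_alg L in
     {free_gen (x + y) \<ominus>\<^bsub>F\<^esub> (free_gen x \<oplus>\<^bsub>F\<^esub> free_gen y) | x y. x \<in> L \<and> y \<in> L} \<union>
     {free_gen (s c x) \<ominus>\<^bsub>F\<^esub> (free_const c \<otimes>\<^bsub>F\<^esub> free_gen x) | c x. x \<in> L} \<union>
     {(free_gen x \<otimes>\<^bsub>F\<^esub> free_gen y \<ominus>\<^bsub>F\<^esub> free_gen y \<otimes>\<^bsub>F\<^esub> free_gen x) \<ominus>\<^bsub>F\<^esub> free_gen (br x y)
        | x y. x \<in> L \<and> y \<in> L})"

definition env_ideal ::
  "('k::field \<Rightarrow> 'l::ab_group_add \<Rightarrow> 'l) \<Rightarrow> ('l \<Rightarrow> 'l \<Rightarrow> 'l) \<Rightarrow> 'l set \<Rightarrow> ('l list \<Rightarrow> 'k) set" where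
  "env_ideal s br L = genideal (free_alg L) (env_rels s br L)"

definition env_alg ::
  "('k::field \<Rightarrow> 'l::ab_group_add \<Rightarrow> 'l) \<Rightarrow> ('l \<Rightarrow> 'l \<Rightarrow> 'l) \<Rightarrow> 'l set \<Rightarrow> ('l list \<Rightarrow> 'k) set ring" where
  "env_alg s br L = free_alg L Quot env_ideal s br L"

definition env_gen ::
  "('k::field \<Rightarrow> 'l::ab_group_add \<Rightarrow> 'l) \<Rightarrow> ('l \<Rightarrow> 'l \<Rightarrow> 'l) \<Rightarrow> 'l set \<Rightarrow> 'l \<Rightarrow> ('l list \<Rightarrow> 'k) set" where
  "env_gen s br L x = env_ideal s br L +>\<^bsub>free_alg L\<^esub> free_gen x"

definition env_const ::
  "('k::field \<Rightarrow> 'l::ab_group_add \<Rightarrow> 'l) \<Rightarrow> ('l \<Rightarrow> 'l \<Rightarrow> 'l) \<Rightarrow> 'l set \<Rightarrow> 'k \<Rightarrow> ('l list \<Rightarrow> 'k) set" where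
  "env_const s br L c = env_ideal s br L +>\<^bsub>free_alg L\<^esub> free_const c"

text \<open>
  The reduced enveloping algebra, for a \<open>p\<close>-map \<open>pm\<close> and a linear form \<open>chi\<close> on \<open>L\<close>.
\<close>

definition red_rels ::
  "('k::field \<Rightarrow> 'l::ab_group_add \<Rightarrow> 'l) \<Rightarrow> ('l \<Rightarrow> 'l \<Rightarrow> 'l) \<Rightarrow> 'l set \<Rightarrow> nat \<Rightarrow> ('l \<Rightarrow> 'l) \<Rightarrow>
    ('l \<Rightarrow> 'k) \<Rightarrow> ('l list \<Rightarrow> 'k) set set" where
  "red_rels s br L p pm chi =
    (let U = env_alg s br L in
     {(env_gen s br L x [^]\<^bsub>U\<^esub> p \<ominus>\<^bsub>U\<^esub> env_gen s br L (pm x)) \<ominus>\<^bsub>U\<^esub> env_const s br L (chi x ^ p)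
        | x. x \<in> L})"

definition red_ideal ::
  "('k::field \<Rightarrow> 'l::ab_group_add \<Rightarrow> 'l) \<Rightarrow> ('l \<Rightarrow> 'l \<Rightarrow> 'l) \<Rightarrow> 'l set \<Rightarrow> nat \<Rightarrow> ('l \<Rightarrow> 'l) \<Rightarrow>
    ('l \<Rightarrow> 'k) \<Rightarrow> ('l list \<Rightarrow> 'k) set set" where
  "red_ideal s br L p pm chi = genideal (env_alg s br L) (red_rels s br L p pm chi)"

definition red_env_alg ::
  "('k::field \<Rightarrow> 'l::ab_group_add \<Rightarrow> 'l) \<Rightarrow> ('l \<Rightarrow> 'l \<Rightarrow> 'l) \<Rightarrow> 'l set \<Rightarrow> nat \<Rightarrow> ('l \<Rightarrow> 'l) \<Rightarrow>
    ('l \<Rightarrow> 'k) \<Rightarrow> ('l list \<Rightarrow> 'k) set set ring" where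
  "red_env_alg s br L p pm chi = env_alg s br L Quot red_ideal s br L p pm chi"

definition red_const ::
  "('k::field \<Rightarrow> 'l::ab_group_add \<Rightarrow> 'l) \<Rightarrow> ('l \<Rightarrow> 'l \<Rightarrow> 'l) \<Rightarrow> 'l set \<Rightarrow> nat \<Rightarrow> ('l \<Rightarrow> 'l) \<Rightarrow>
    ('l \<Rightarrow> 'k) \<Rightarrow> 'k \<Rightarrow> ('l list \<Rightarrow> 'k) set set" where
  "red_const s br L p pm chi c =
    red_ideal s br L p pm chi +>\<^bsub>env_alg s br L\<^esub> env_const s br L c"

definition lie_dual ::
  "('k::field \<Rightarrow> 'l::ab_group_add \<Rightarrow> 'l) \<Rightarrow> 'l set \<Rightarrow> ('l \<Rightarrow> 'k) set" where
  "lie_dual s L = {chi. (\<forall>x\<in>L. \<forall>y\<in>L. chi (x + y) = chi x + chi y) \<and>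
                        (\<forall>c. \<forall>x\<in>L. chi (s c x) = c * chi x)}"

text \<open>
  The codimension of the stabilizer in \<open>L\<close> is the rank of the alternating form
  \<open>chi (br x y)\<close>, hence even; halving it with \<open>div\<close> loses nothing.
\<close>

definition lie_stab ::
  "('l \<Rightarrow> 'l \<Rightarrow> 'l) \<Rightarrow> 'l set \<Rightarrow> ('l \<Rightarrow> 'k::field) \<Rightarrow> 'l set" where
  "lie_stab br L chi = {x \<in> L. \<forall>y\<in>L. chi (br x y) = 0}"

section \<open>Modules over a not necessarily commutative ring\<close>

text \<open>The locale \<open>module\<close> of HOL-Algebra is restricted to commutative rings.\<close>

locale left_module = ring R for R :: "('a, 'b) ring_scheme" (structure)
  and act :: "'a \<Rightarrow> 'v::ab_group_add \<Rightarrow> 'v" +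
  assumes act_add_left: "\<lbrakk>a \<in> carrier R; b \<in> carrier R\<rbrakk> \<Longrightarrow> act (a \<oplus> b) v = act a v + act b v"
    and act_add_right: "a \<in> carrier R \<Longrightarrow> act a (v + w) = act a v + act a w"
    and act_mult: "\<lbrakk>a \<in> carrier R; b \<in> carrier R\<rbrakk> \<Longrightarrow> act (a \<otimes> b) v = act a (act b v)"
    and act_one: "act \<one> v = v"

definition is_submodule ::
  "('a, 'b) ring_scheme \<Rightarrow> ('a \<Rightarrow> 'v::ab_group_add \<Rightarrow> 'v) \<Rightarrow> 'v set \<Rightarrow> bool" where
  "is_submodule R act N \<longleftrightarrow>
    0 \<in> N \<and> (\<forall>v\<in>N. \<forall>w\<in>N. v + w \<in> N) \<and> (\<forall>a\<in>carrier R. \<forall>v\<in>N. act a v \<in> N)"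

definition simple_module ::
  "('a, 'b) ring_scheme \<Rightarrow> ('a \<Rightarrow> 'v::ab_group_add \<Rightarrow> 'v) \<Rightarrow> bool" where
  "simple_module R act \<longleftrightarrow>
    left_module R act \<and> (\<exists>v::'v. v \<noteq> 0) \<and>
    (\<forall>N. is_submodule R act N \<longrightarrow> N = {0} \<or> N = UNIV)"

section \<open>Truncated current algebras\<close>

text \<open>
  The element \<open>\<Sum>i. x\<^sub>i \<otimes> t\<^sup>i\<close> of \<open>Mat\<^sub>2(k) \<otimes> k[t]/(t\<^bsup>m+1\<^esup>)\<close> is represented by the polynomial of
  degree at most \<open>m\<close> with matrix coefficients \<open>x\<^sub>i\<close>; in particular \<open>x \<otimes> t\<^sup>i\<close> is \<open>monom x i\<close>.
  The product of the type \<open>'k^2^2\<close> is componentwise and is never used: matrices are multiplied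
  by \<open>**\<close>.
\<close>

type_synonym 'k mat2 = "'k^2^2"

definition cur_scale :: "'k::field \<Rightarrow> 'k mat2 poly \<Rightarrow> 'k mat2 poly" where
  "cur_scale c u = map_poly (\<lambda>A. \<chi> i j. c * A $ i $ j) u"

definition cur_mult :: "nat \<Rightarrow> 'k::field mat2 poly \<Rightarrow> 'k mat2 poly \<Rightarrow> 'k mat2 poly" where
  "cur_mult m u v = (\<Sum>i\<le>m. \<Sum>j\<le>m - i. monom (coeff u i ** coeff v j) (i + j))"

definition cur_bracket :: "nat \<Rightarrow> 'k::field mat2 poly \<Rightarrow> 'k mat2 poly \<Rightarrow> 'k mat2 poly" where
  "cur_bracket m u v =
    (\<Sum>i\<le>m. \<Sum>j\<le>m - i. monom (coeff u i ** coeff v j - coeff v j ** coeff u i) (i + j))"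

definition mat_pow :: "'k::field mat2 \<Rightarrow> nat \<Rightarrow> 'k mat2" where
  "mat_pow A n = (((**) A) ^^ n) (mat 1)"

text \<open>
  The \<open>p\<close>-th power in the associative algebra \<open>Mat\<^sub>2(k) \<otimes> k[t]/(t\<^bsup>m+1\<^esup>)\<close>. In characteristic \<open>p\<close> it is
  a \<open>p\<close>-map on the Lie algebra of this algebra, and it has the prescribed values at the elements
  \<open>x \<otimes> t\<^sup>i\<close> (see \<open>cur_pmap_monom\<close> below); as these span, no other \<open>p\<close>-map has these values.
\<close>

definition cur_pmap :: "nat \<Rightarrow> nat \<Rightarrow> 'k::field mat2 poly \<Rightarrow> 'k mat2 poly" where
  "cur_pmap m p u = ((cur_mult m u) ^^ p) (monom (mat 1) 0)"

definition cur_sl2 :: "nat \<Rightarrow> 'k::field mat2 poly set" where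
  "cur_sl2 m = {u. degree u \<le> m \<and> (\<forall>i. trace (coeff u i) = 0)}"

definition sl2_red_env :: "nat \<Rightarrow> nat \<Rightarrow> ('k::field mat2 poly \<Rightarrow> 'k) \<Rightarrow>
    ('k mat2 poly list \<Rightarrow> 'k) set set ring" where
  "sl2_red_env m p chi = red_env_alg cur_scale (cur_bracket m) (cur_sl2 m) p (cur_pmap m p) chi"

definition sl2_red_const :: "nat \<Rightarrow> nat \<Rightarrow> ('k::field mat2 poly \<Rightarrow> 'k) \<Rightarrow> 'k \<Rightarrow>
    ('k mat2 poly list \<Rightarrow> 'k) set set" where
  "sl2_red_const m p chi = red_const cur_scale (cur_bracket m) (cur_sl2 m) p (cur_pmap m p) chi"

text \<open>The \<open>k\<close>-dimension of a module over \<open>U\<^sub>\<chi>\<close>; scalars act through \<open>k \<rightarrow> U\<^sub>\<chi>\<close>.\<close>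

definition sl2_module_dim :: "nat \<Rightarrow> nat \<Rightarrow> ('k::field mat2 poly \<Rightarrow> 'k) \<Rightarrow>
    (('k mat2 poly list \<Rightarrow> 'k) set set \<Rightarrow> 'v::ab_group_add \<Rightarrow> 'v) \<Rightarrow> nat" where
  "sl2_module_dim m p chi act =
    vector_space.dim (\<lambda>c. act (sl2_red_const m p chi c)) (UNIV :: 'v set)"

section \<open>Well-definedness\<close>

lemma cur_mult_monom:
  "i \<le> m \<Longrightarrow> j \<le> m \<Longrightarrow>
    cur_mult m (monom x i) (monom y j) = (if i + j \<le> m then monom (x ** y) (i + j) else 0)"
proof -
  assume ij: "i \<le> m" "j \<le> m"
  have "monom (coeff (monom x i) a ** coeff (monom y j) b) (a + b) =
      (if i = a then if j = b then monom (x ** y) (i + j) else 0 else 0)" for a b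
    by auto
  hence "cur_mult m (monom x i) (monom y j)
     = (\<Sum>a\<le>m. \<Sum>b\<le>m - a. if i = a then if j = b then monom (x ** y) (i + j) else 0 else 0)"
    by (simp only: cur_mult_def)
  also have "\<dots> = (\<Sum>a\<le>m. if i = a then \<Sum>b\<le>m - i. if j = b then monom (x ** y) (i + j) else 0 else 0)"
    by (intro sum.cong refl) auto
  also have "\<dots> = (if i + j \<le> m then monom (x ** y) (i + j) else 0)"
    using ij by auto
  finally show ?thesis .
qed

lemma cur_mult_zero [simp]: "cur_mult m u 0 = 0"
  by (simp add: cur_mult_def)

lemma cur_pmap_monom:
  assumes "i \<le> m"
  shows "cur_pmap m p (monom x i) = (if p * i \<le> m then monom (mat_pow x p) (p * i) else 0)"
  unfolding cur_pmap_def mat_pow_def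
  by (induction p) (use assms in \<open>auto simp: cur_mult_monom\<close>)

lemma cur_bracket_eq: "cur_bracket m u v = cur_mult m u v - cur_mult m v u"
proof -
  have sw: "(\<Sum>i\<le>m. \<Sum>j\<le>m - i. f i j) = (\<Sum>j\<le>m. \<Sum>i\<le>m - j. f i j)"
    for f :: "nat \<Rightarrow> nat \<Rightarrow> 'a mat2 poly"
    by (simp add: sum.Sigma)
      (rule sum.reindex_bij_witness[of _ "\<lambda>(a, b). (b, a)" "\<lambda>(a, b). (b, a)"]; auto)
  have "cur_mult m v u = (\<Sum>i\<le>m. \<Sum>j\<le>m - i. monom (coeff v j ** coeff u i) (i + j))"
    unfolding cur_mult_def by (subst sw) (simp add: add.commute)
  thus ?thesis
    by (simp add: cur_bracket_def cur_mult_def diff_monom[symmetric] sum_subtractf)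
qed

lemma free_alg_simps:
  "carrier (free_alg X) = {f. finite {w. f w \<noteq> 0} \<and> {w. f w \<noteq> 0} \<subseteq> lists X}"
  "f \<otimes>\<^bsub>free_alg X\<^esub> g = (\<lambda>w. \<Sum>i\<le>length w. f (take i w) * g (drop i w))"
  "\<one>\<^bsub>free_alg X\<^esub> = (\<lambda>w. if w = [] then 1 else 0)"
  "\<zero>\<^bsub>free_alg X\<^esub> = (\<lambda>w. 0)"
  "f \<oplus>\<^bsub>free_alg X\<^esub> g = (\<lambda>w. f w + g w)"
  by (simp_all add: free_alg_def)

lemma free_alg_mult_closed:
  fixes f g :: "'l list \<Rightarrow> 'k::field"
  assumes "f \<in> carrier (free_alg X)" "g \<in> carrier (free_alg X)"
  shows "f \<otimes>\<^bsub>free_alg X\<^esub> g \<in> carrier (free_alg X)"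
proof -
  let ?h = "\<lambda>w. \<Sum>i\<le>length w. f (take i w) * g (drop i w)"
  have sub: "{w. ?h w \<noteq> 0} \<subseteq> (\<lambda>(u, v). u @ v) ` ({w. f w \<noteq> 0} \<times> {w. g w \<noteq> 0})"
  proof
    fix w assume "w \<in> {w. ?h w \<noteq> 0}"
    then obtain i where "f (take i w) * g (drop i w) \<noteq> 0"
      by (force elim: sum.not_neutral_contains_not_neutral)
    thus "w \<in> (\<lambda>(u, v). u @ v) ` ({w. f w \<noteq> 0} \<times> {w. g w \<noteq> 0})"
      by (force intro: rev_image_eqI[of "(take i w, drop i w)"])
  qed
  have "finite {w. ?h w \<noteq> 0}"
    by (rule finite_subset[OF sub]) (use assms in \<open>auto simp: free_alg_simps\<close>)
  moreover have "{w. ?h w \<noteq> 0} \<subseteq> lists X"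
  proof
    fix w assume "w \<in> {w. ?h w \<noteq> 0}"
    from subsetD[OF sub this] obtain u v where "w = u @ v" "f u \<noteq> 0" "g v \<noteq> 0"
      by auto
    thus "w \<in> lists X" using assms by (auto simp: free_alg_simps subset_iff)
  qed
  ultimately show ?thesis by (simp add: free_alg_simps)
qed

lemma free_alg_assoc:
  fixes f g h :: "'l list \<Rightarrow> 'k::field"
  shows "f \<otimes>\<^bsub>free_alg X\<^esub> g \<otimes>\<^bsub>free_alg X\<^esub> h = f \<otimes>\<^bsub>free_alg X\<^esub> (g \<otimes>\<^bsub>free_alg X\<^esub> h)"
proof (rule ext)
      fix w :: "'l list"
      let ?n = "length w"
      have "(\<Sum>i\<le>?n. (\<Sum>j\<le>length (take i w). f (take j (take i w)) * g (drop j (take i w))) * h (drop i w))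
        = (\<Sum>i\<le>?n. \<Sum>j\<le>i. f (take j w) * (g (drop j (take i w)) * h (drop i w)))"
        by (intro sum.cong) (auto simp: sum_distrib_right mult.assoc min_def)
      also have "\<dots> = (\<Sum>j\<le>?n. \<Sum>i\<in>{j..?n}. f (take j w) * (g (drop j (take i w)) * h (drop i w)))"
        by (simp add: sum.Sigma)
          (rule sum.reindex_bij_witness[of _ "\<lambda>(a, b). (b, a)" "\<lambda>(a, b). (b, a)"]; auto)
      also have "\<dots> = (\<Sum>j\<le>?n. \<Sum>i\<le>?n - j. f (take j w) * (g (take i (drop j w)) * h (drop i (drop j w))))"
      proof (rule sum.cong[OF refl])
        fix j assume "j \<in> {..?n}"
        thus "(\<Sum>i\<in>{j..?n}. f (take j w) * (g (drop j (take i w)) * h (drop i w))) =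
          (\<Sum>i\<le>?n - j. f (take j w) * (g (take i (drop j w)) * h (drop i (drop j w))))"
          by (intro sum.reindex_bij_witness[of _ "\<lambda>i. i + j" "\<lambda>i. i - j"])
            (auto simp: drop_take add.commute)
      qed
      finally show "(f \<otimes>\<^bsub>free_alg X\<^esub> g \<otimes>\<^bsub>free_alg X\<^esub> h) w = (f \<otimes>\<^bsub>free_alg X\<^esub> (g \<otimes>\<^bsub>free_alg X\<^esub> h)) w"
        by (simp only: free_alg_simps sum_distrib_left length_drop)
qed

lemma free_alg_one_left: "\<one>\<^bsub>free_alg X\<^esub> \<otimes>\<^bsub>free_alg X\<^esub> f = f"
proof (rule ext)
  fix w
  have "(\<Sum>i\<le>length w. (if take i w = [] then 1 else 0) * f (drop i w)) =
      (\<Sum>i\<le>length w. if i = 0 then f w else 0)"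
    by (intro sum.cong refl) auto
  thus "(\<one>\<^bsub>free_alg X\<^esub> \<otimes>\<^bsub>free_alg X\<^esub> f) w = f w"
    by (simp add: free_alg_def)
qed

lemma free_alg_one_right: "f \<otimes>\<^bsub>free_alg X\<^esub> \<one>\<^bsub>free_alg X\<^esub> = f"
proof (rule ext)
  fix w
  have "(\<Sum>i\<le>length w. f (take i w) * (if drop i w = [] then 1 else 0)) =
      (\<Sum>i\<le>length w. if i = length w then f w else 0)"
    by (intro sum.cong refl) auto
  thus "(f \<otimes>\<^bsub>free_alg X\<^esub> \<one>\<^bsub>free_alg X\<^esub>) w = f w"
    by (simp add: free_alg_def)
qed

lemma ring_free_alg: "ring (free_alg X :: ('l list \<Rightarrow> 'k::field) ring)"
proof (rule ringI)
  let ?F = "free_alg X :: ('l list \<Rightarrow> 'k) ring"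
  show "abelian_group ?F"
  proof (rule abelian_groupI)
    fix f g assume fg: "f \<in> carrier ?F" "g \<in> carrier ?F"
    have "{w. f w + g w \<noteq> 0} \<subseteq> {w. f w \<noteq> 0} \<union> {w. g w \<noteq> 0}" by auto
    moreover from this have "finite {w. f w + g w \<noteq> 0}"
      by (rule finite_subset) (use fg in \<open>auto simp: free_alg_simps\<close>)
    ultimately show "f \<oplus>\<^bsub>?F\<^esub> g \<in> carrier ?F" using fg by (auto simp: free_alg_simps)
  next
    fix f assume "f \<in> carrier ?F"
    thus "\<exists>g\<in>carrier ?F. g \<oplus>\<^bsub>?F\<^esub> f = \<zero>\<^bsub>?F\<^esub>"
      by (intro bexI[of _ "\<lambda>w. - f w"]) (auto simp: free_alg_simps)
  qed (auto simp: free_alg_simps add.assoc intro: add.commute)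
  show "Group.monoid ?F"
  proof (rule monoidI)
    show "\<one>\<^bsub>?F\<^esub> \<in> carrier ?F" by (auto simp: free_alg_simps)
  qed (simp_all only: free_alg_mult_closed free_alg_assoc free_alg_one_left free_alg_one_right)
qed (simp_all only: free_alg_simps distrib_left distrib_right sum.distrib)

lemma free_gen_closed: "x \<in> X \<Longrightarrow> free_gen x \<in> carrier (free_alg X)"
  by (auto simp: free_alg_simps free_gen_def)

lemma free_const_closed: "free_const c \<in> carrier (free_alg X)"
proof -
  have "{w. free_const c w \<noteq> 0} \<subseteq> {[]}" by (auto simp: free_const_def)
  thus ?thesis by (auto simp: free_alg_simps dest: finite_subset)
qed

locale lie_carrier =
  fixes s :: "'k::field \<Rightarrow> 'l::ab_group_add \<Rightarrow> 'l" and br :: "'l \<Rightarrow> 'l \<Rightarrow> 'l" and L :: "'l set"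
  assumes add_closed: "x \<in> L \<Longrightarrow> y \<in> L \<Longrightarrow> x + y \<in> L"
    and s_closed: "x \<in> L \<Longrightarrow> s c x \<in> L"
    and br_closed: "x \<in> L \<Longrightarrow> y \<in> L \<Longrightarrow> br x y \<in> L"
begin

lemma ideal_env_ideal: "ideal (env_ideal s br L) (free_alg L)"
proof -
  interpret F: ring "free_alg L :: ('l list \<Rightarrow> 'k) ring" by (rule ring_free_alg)
  note [simp, intro] = free_gen_closed free_const_closed add_closed s_closed br_closed
  show ?thesis
    unfolding env_ideal_def
    by (rule F.genideal_ideal) (auto simp: env_rels_def Let_def)
qed

lemma ring_env_alg: "ring (env_alg s br L)"
  unfolding env_alg_def by (rule ideal.quotient_is_ring[OF ideal_env_ideal])

lemma env_coset_closed:
  "f \<in> carrier (free_alg L) \<Longrightarrow> env_ideal s br L +>\<^bsub>free_alg L\<^esub> f \<in> carrier (env_alg s br L)"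
  unfolding env_alg_def FactRing_def A_RCOSETS_def' partial_object.simps by blast

lemma ideal_red_ideal:
  assumes "\<And>x. x \<in> L \<Longrightarrow> pm x \<in> L"
  shows "ideal (red_ideal s br L p pm chi) (env_alg s br L)"
proof -
  interpret U: ring "env_alg s br L" by (rule ring_env_alg)
  have [simp, intro]: "env_gen s br L x \<in> carrier (env_alg s br L)" if "x \<in> L" for x
    unfolding env_gen_def by (rule env_coset_closed[OF free_gen_closed[OF that]])
  have [simp, intro]: "env_const s br L c \<in> carrier (env_alg s br L)" for c
    unfolding env_const_def by (rule env_coset_closed[OF free_const_closed])
  show ?thesis
    unfolding red_ideal_def
    by (rule U.genideal_ideal) (auto simp: red_rels_def Let_def intro!: assms)
qed

lemma ring_red_env_alg:
  assumes "\<And>x. x \<in> L \<Longrightarrow> pm x \<in> L"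
  shows "ring (red_env_alg s br L p pm chi)"
  unfolding red_env_alg_def by (rule ideal.quotient_is_ring[OF ideal_red_ideal[OF assms]])

end

lemma coeff_cur_scale: "coeff (cur_scale c u) n = (\<chi> i j. c * coeff u n $ i $ j)"
  unfolding cur_scale_def by (subst coeff_map_poly) (auto simp: vec_eq_iff)

lemma vector_space_cur_scale: "vector_space cur_scale"
  by unfold_locales (auto simp: poly_eq_iff coeff_cur_scale vec_eq_iff algebra_simps)

lemma degree_cur_mult: "degree (cur_mult m u v) \<le> m"
  unfolding cur_mult_def
  by (intro degree_sum_le) (auto intro!: degree_sum_le order.trans[OF degree_monom_le])

lemma coeff_cur_mult:
  "coeff (cur_mult m u v) n =
    (\<Sum>i\<le>m. \<Sum>j\<le>m - i. if i + j = n then coeff u i ** coeff v j else 0)"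
  by (simp add: cur_mult_def coeff_sum)

lemma trace_cur_bracket: "trace (coeff (cur_bracket m u v) n) = 0"
proof -
  have tr: "trace (sum f A) = (\<Sum>i\<in>A. trace (f i))" for f :: "nat \<Rightarrow> 'a mat2" and A
    by (induction A rule: infinite_finite_induct) (simp_all add: trace_add, simp_all add: trace_def)
  have "trace (coeff u i ** coeff v j - coeff v j ** coeff u i) = 0" for i j
    by (simp add: trace_sub trace_mul_sym[of "coeff u i"])
  hence "trace (if i + j = n then coeff u i ** coeff v j - coeff v j ** coeff u i else 0) = 0" for i j
    by (auto simp: trace_def)
  thus ?thesis
    by (simp add: cur_bracket_def coeff_sum tr)
qed

lemma lie_carrier_cur_sl2: "lie_carrier cur_scale (cur_bracket m) (cur_sl2 m)"
proof
  fix x y :: "'a mat2 poly" and c :: 'a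
  assume x: "x \<in> cur_sl2 m"
  have "degree (cur_scale c x) \<le> degree x"
    by (rule degree_le) (simp add: coeff_cur_scale coeff_eq_0 vec_eq_iff)
  moreover have "trace (coeff (cur_scale c x) i) = c * trace (coeff x i)" for i
    by (simp add: coeff_cur_scale trace_def sum_distrib_left)
  ultimately show "cur_scale c x \<in> cur_sl2 m"
    using x by (auto simp: cur_sl2_def)
  assume y: "y \<in> cur_sl2 m"
  show "x + y \<in> cur_sl2 m"
    using x y by (auto simp: cur_sl2_def trace_add intro: degree_add_le)
  show "cur_bracket m x y \<in> cur_sl2 m"
    by (simp add: cur_sl2_def trace_cur_bracket, simp add: cur_bracket_eq degree_diff_le degree_cur_mult)
qed

end

theory Submission
  imports Defs "HOL-Computational_Algebra.Formal_Power_Series"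
begin

text \<open>
  Let \<open>d\<close> be the largest degree such that \<open>\<chi>\<close> does not vanish on \<open>sl\<^sub>2 \<otimes> t\<^sup>d\<close>; if there is none, the exponent
  is \<open>0\<close>. The proof bounds the exponent from above by \<open>d + 1\<close> and shows that \<open>p\<^bsup>d+1\<^esup>\<close> divides \<open>dim M\<close>.

  Nilpotent matrices span \<open>sl\<^sub>2\<close>, so some nilpotent \<open>e\<close> has \<open>\<chi>(e t\<^sup>d) \<noteq> 0\<close>, and it can be completed to a
  basis \<open>e, h, f\<close> with \<open>[h, e] = 2e\<close>. With this choice of basis the same argument covers semisimple and
  nilpotent leading terms of \<open>\<chi>\<close>.

  For the exponent, an element \<open>u\<close> stabilizes \<open>\<chi>\<close> as soon as \<open>\<chi>([u, e t\<^sup>k]) = \<chi>([u, h t\<^sup>k]) = 0\<close> for all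
  \<open>k \<le> d\<close> (\<open>in_stab_of_two_rows\<close>). These are \<open>2(d + 1)\<close> linear conditions, hence \<open>codim_lie_stab_le\<close>.

  For the divisibility, the ideal spanned by the \<open>x t\<^sup>i\<close> with \<open>i > d\<close> acts by nilpotent operators, because
  \<open>\<chi>\<close> vanishes on it and its \<open>p\<close>-map raises degrees; as \<open>M\<close> is simple, it acts by zero
  (\<open>rho_monom_eq_0_above\<close>). Consider then the operators
  \<open>X\<^sub>i = e t\<^bsup>d-i\<^esup> - \<chi>(e t\<^bsup>d-i\<^esup>)\<close> and \<open>Y\<^sub>i = (e t\<^sup>d)\<^bsup>p-1\<^esup> (h t\<^sup>i)\<close> for \<open>0 \<le> i \<le> d\<close>. The \<open>X\<^sub>i\<close> commute and have
  \<open>p\<close>-th power zero, since \<open>e\<^sup>2 = 0\<close>. From \<open>[e t\<^sup>a, h t\<^sup>b] = -2 e t\<^bsup>a+b\<^esup>\<close> one gets \<open>[X\<^sub>i, Y\<^sub>j] = 0\<close> for \<open>i < j\<close>, where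
  the degree exceeds \<open>d\<close>, and \<open>[X\<^sub>i, Y\<^sub>i] = -2 (e t\<^sup>d)\<^sup>p = -2 \<chi>(e t\<^sup>d)\<^sup>p\<close>, a nonzero scalar. So
  \<open>X\<^sub>i, Y\<^sub>i\<close> is a Weyl pair (its commutator is a nonzero scalar) on the common kernel of
  \<open>X\<^sub>0, \<dots>, X\<^bsub>i-1\<^esub>\<close>, and a Weyl pair in characteristic \<open>p\<close> whose first member has \<open>p\<close>-th power zero
  contributes a factor \<open>p\<close> to the dimension
  (\<open>dim_weyl_pair\<close>, \<open>dim_weyl_system\<close>).
\<close>

section \<open>Weyl pairs in characteristic p\<close>

text \<open>
  Rank-nullity on a subspace: a basis \<open>B\<close> of the kernel is extended to a basis \<open>C\<close> of \<open>W\<close>, and \<open>f\<close> is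
  injective on the span of \<open>C - B\<close>.
\<close>
lemma (in finite_dimensional_vector_space) dim_kernel_image:
  assumes f: "Vector_Spaces.linear scale scale f" and W: "subspace W"
  shows "dim W = dim {v \<in> W. f v = 0} + dim (f ` W)"
proof -
  interpret f: Vector_Spaces.linear scale scale f by (rule f)
  interpret pair: finite_dimensional_vector_space_pair_1 scale Basis scale by unfold_locales
  let ?K = "{v \<in> W. f v = 0}"
  have K: "subspace ?K"
    using W by (auto simp: subspace_def f.add f.scale)
  obtain B where B: "B \<subseteq> ?K" "independent B" "?K \<subseteq> span B" "card B = dim ?K"
    using basis_exists[of ?K] by blast
  obtain C where C: "B \<subseteq> C" "C \<subseteq> W" "independent C" "W \<subseteq> span C"
    using maximal_independent_subset_extend[of B W] B by blast
  let ?D = "span (C - B)"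
  have fin: "finite C" using C finiteI_independent by blast
  have D: "?D \<subseteq> W" using C W by (intro span_minimal) auto
  have spB: "span B = ?K" using B K by (simp add: span_subspace)
  have spC: "span C = W" using C W by (simp add: span_subspace)
  have "C = B \<union> (C - B)" using C by blast
  hence sum: "{x + y |x y. x \<in> ?K \<and> y \<in> ?D} = W"
    using span_Un[of B "C - B"] spB spC by simp
  have "dim ?D = card C - card B"
    using C(1,3) fin by (metis card_Diff_subset dim_span_eq_card_independent finite_subset
        independent_mono Diff_subset)
  moreover have "card B \<le> card C" using C fin by (simp add: card_mono)
  moreover have dimW: "dim W = card C" by (rule basis_card_eq_dim[OF C(2,4,3), symmetric])
  ultimately have split: "dim W = dim ?K + dim ?D" using B by simp
  hence "dim (?K \<inter> ?D) = 0"
    using dim_sums_Int[OF K subspace_span[of "C - B"]] unfolding sum by linarith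
  hence triv: "?K \<inter> ?D \<subseteq> {0}" by (simp only: dim_eq_0)
  have "inj_on f ?D"
  proof (rule inj_onI)
    fix x y assume xy: "x \<in> ?D" "y \<in> ?D" "f x = f y"
    hence "x - y \<in> ?D" by (simp add: span_diff)
    moreover have "x - y \<in> ?K" using calculation D xy by (auto simp: f.diff)
    ultimately show "x = y" using triv by auto
  qed
  hence "dim (f ` ?D) = dim ?D"
    using pair.dim_image_eq[OF f, of ?D] by (simp add: span_span)
  moreover have "f ` ?D = f ` W"
  proof
    show "f ` W \<subseteq> f ` ?D"
    proof
      fix w assume "w \<in> f ` W"
      then obtain v where "v \<in> W" and w: "w = f v" by blast
      have "v \<in> {x + y |x y. x \<in> ?K \<and> y \<in> ?D}" using \<open>v \<in> W\<close> unfolding sum by simp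
      then obtain x y where "f x = 0" "y \<in> ?D" "w = f (x + y)"
        using w by blast
      thus "w \<in> f ` ?D" by (simp add: f.add)
    qed
  qed (use D in blast)
  ultimately show ?thesis using split by simp
qed

text \<open>
  The derivation rule \<open>[X\<^bsup>n+1\<^esup>, Y] = (n + 1) c X\<^sup>n\<close>, on a subspace where \<open>[X, Y] = c\<close>.
\<close>
lemma (in vector_space) commute_funpow_of_weyl_pair:
  assumes X: "Vector_Spaces.linear scale scale X" and Y0: "Y 0 = 0"
    and XW: "\<And>v. v \<in> W \<Longrightarrow> X v \<in> W"
    and rel: "\<And>v. v \<in> W \<Longrightarrow> X (Y v) = Y (X v) + scale c v"
    and v: "v \<in> W"
  shows "(X ^^ Suc n) (Y v) = Y ((X ^^ Suc n) v) + scale (of_nat (Suc n) * c) ((X ^^ n) v)"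
proof (induction n)
  case 0
  show ?case using rel[OF v] by simp
next
  case (Suc n)
  interpret X: Vector_Spaces.linear scale scale X by (rule X)
  have inW: "(X ^^ k) v \<in> W" for k by (induction k) (use v XW in auto)
  define z where "z = (X ^^ Suc n) v"
  have "(X ^^ Suc (Suc n)) (Y v) = X (Y z + scale (of_nat (Suc n) * c) ((X ^^ n) v))"
    by (simp only: funpow.simps(2)[of "Suc n"] o_apply Suc.IH z_def)
  also have "\<dots> = X (Y z) + scale (of_nat (Suc n) * c) z"
    by (simp add: X.add X.scale z_def)
  also have "\<dots> = Y (X z) + (scale c z + scale (of_nat (Suc n) * c) z)"
    using rel[OF inW[of "Suc n"]] by (simp add: z_def)
  also have "scale c z + scale (of_nat (Suc n) * c) z = scale (of_nat (Suc (Suc n)) * c) z"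
    by (simp add: algebra_simps flip: scale_left_distrib)
  finally show ?case by (simp add: z_def)
qed

text \<open>
  Filter \<open>W\<close> by the kernels \<open>K\<^sub>j\<close> of \<open>X\<^sup>j\<close>. For \<open>j < p\<close> the derivation rule makes \<open>K\<^sub>j\<close> part of the image
  of \<open>X\<close>, so \<open>X\<close> maps \<open>K\<^bsub>j+1\<^esub>\<close> onto \<open>K\<^sub>j\<close> with kernel \<open>K\<^sub>1\<close>: every Jordan block of the nilpotent operator \<open>X\<close>
  has size exactly \<open>p\<close>.
\<close>
lemma (in finite_dimensional_vector_space) dim_weyl_pair:
  assumes X: "Vector_Spaces.linear scale scale X" and Y0: "Y 0 = 0" and W: "subspace W"
    and XW: "\<And>v. v \<in> W \<Longrightarrow> X v \<in> W" and YW: "\<And>v. v \<in> W \<Longrightarrow> Y v \<in> W"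
    and rel: "\<And>v. v \<in> W \<Longrightarrow> X (Y v) = Y (X v) + scale c v" and c: "c \<noteq> 0"
    and nil: "\<And>v. v \<in> W \<Longrightarrow> (X ^^ CHAR('a)) v = 0"
  shows "dim W = CHAR('a) * dim {v \<in> W. X v = 0}"
proof -
  interpret X: Vector_Spaces.linear scale scale X by (rule X)
  define K where "K j = {v \<in> W. (X ^^ j) v = 0}" for j
  have pow: "Vector_Spaces.linear scale scale (X ^^ j)" for j
  proof (induction j)
    case 0
    show ?case by (simp only: funpow.simps(1) linear_id)
  next
    case (Suc j)
    show ?case unfolding funpow.simps(2) by (rule Vector_Spaces.linear_compose[OF Suc X])
  qed
  have K: "subspace (K j)" for j
  proof -
    interpret P: Vector_Spaces.linear scale scale "X ^^ j" by (rule pow)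
    show ?thesis using W by (auto simp: K_def subspace_def P.add P.scale P.zero)
  qed
  have surj: "\<exists>u\<in>W. X u = v" if "j < CHAR('a)" "v \<in> K j" for j v
    using that
  proof (induction j arbitrary: v)
    case 0
    thus ?case using W by (auto simp: K_def subspace_def intro!: bexI[of _ 0])
  next
    case (Suc j)
    interpret P: Vector_Spaces.linear scale scale "X ^^ j" by (rule pow)
    have v: "v \<in> W" "(X ^^ Suc j) v = 0" using Suc.prems by (auto simp: K_def)
    let ?a = "of_nat (Suc j) * c :: 'a"
    \<comment> \<open>\<open>X\<^sup>j\<close> kills \<open>X Y v - (j + 1) c v\<close>, which is therefore in the image of \<open>X\<close> by induction; dividing by
      \<open>(j + 1) c\<close> needs \<open>j + 1 < p\<close>.\<close>
    have "of_nat (Suc j) \<noteq> (0 :: 'a)"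
      unfolding of_nat_eq_0_iff_char_dvd using Suc.prems(1) by (auto dest: dvd_imp_le)
    hence a: "?a \<noteq> 0" using c by simp
    have "(X ^^ j) (X (Y v)) = (X ^^ Suc j) (Y v)"
      by (simp only: funpow_Suc_right o_apply)
    also have "\<dots> = scale ?a ((X ^^ j) v)"
      using commute_funpow_of_weyl_pair[where W = W and X = X, OF X Y0 XW rel v(1), of j] v(2) Y0 by simp
    finally have "(X ^^ j) (X (Y v) - scale ?a v) = 0"
      by (simp add: P.diff P.scale)
    hence "X (Y v) - scale ?a v \<in> K j"
      using W XW YW v by (simp add: K_def subspace_diff subspace_scale)
    then obtain u where u: "u \<in> W" "X u = X (Y v) - scale ?a v"
      using Suc.IH[of "X (Y v) - scale ?a v"] Suc.prems by auto
    have "scale ?a v = X (Y v - u)" using u by (simp add: X.diff)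
    hence "scale (inverse ?a) (scale ?a v) = X (scale (inverse ?a) (Y v - u))"
      by (simp only: X.scale)
    hence "v = X (scale (inverse ?a) (Y v - u))"
      using left_inverse[OF a] by (simp only: scale_scale scale_one)
    thus ?case using u W YW v by (metis subspace_diff subspace_scale)
  qed
  have step: "dim (K (Suc j)) = dim (K 1) + dim (K j)" if j: "j < CHAR('a)" for j
  proof -
    have "X ` K (Suc j) = K j"
    proof
      show "X ` K (Suc j) \<subseteq> K j" using XW by (auto simp: K_def funpow_swap1)
      show "K j \<subseteq> X ` K (Suc j)"
      proof
        fix v assume v: "v \<in> K j"
        then obtain u where u: "u \<in> W" "X u = v" using surj j by blast
        hence "u \<in> K (Suc j)" using v by (auto simp: K_def funpow_swap1)
        thus "v \<in> X ` K (Suc j)" using u by blast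
      qed
    qed
    moreover have "{v \<in> K (Suc j). X v = 0} = K 1"
    proof -
      have "(X ^^ j) 0 = 0" by (induction j) (auto simp: X.zero)
      thus ?thesis by (auto simp: K_def funpow_swap1)
    qed
    ultimately show ?thesis using dim_kernel_image[OF X K[of "Suc j"]] by simp
  qed
  have "dim (K j) = j * dim (K 1)" if "j \<le> CHAR('a)" for j
    using that
  proof (induction j)
    case 0
    have "K 0 \<subseteq> {0}" by (auto simp: K_def)
    thus ?case by (simp only: dim_eq_0 mult_0)
  next
    case (Suc j)
    thus ?case using step[of j] by simp
  qed
  moreover have "K CHAR('a) = W" using nil by (auto simp: K_def)
  moreover have "K 1 = {v \<in> W. X v = 0}" by (auto simp: K_def)
  ultimately show ?thesis by (metis order_refl)
qed

text \<open>
  The vanishing of \<open>[X\<^sub>i, Y\<^sub>j]\<close> is required for \<open>i < j\<close> only: that is what makes \<open>Y\<^sub>k\<close> preserve the common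
  kernel of \<open>X\<^sub>0, \<dots>, X\<^bsub>k-1\<^esub>\<close>, so that the Weyl pairs can be split off one after the other.
\<close>
lemma (in finite_dimensional_vector_space) dim_weyl_system:
  fixes X Y :: "nat \<Rightarrow> 'b \<Rightarrow> 'b"
  assumes X: "\<And>i. i < n \<Longrightarrow> Vector_Spaces.linear scale scale (X i)"
    and Y0: "\<And>i. i < n \<Longrightarrow> Y i 0 = 0"
    and XX: "\<And>i j v. i < n \<Longrightarrow> j < n \<Longrightarrow> X i (X j v) = X j (X i v)"
    and XY: "\<And>i j v. i < j \<Longrightarrow> j < n \<Longrightarrow> X i (Y j v) = Y j (X i v)"
    and rel: "\<And>i v. i < n \<Longrightarrow> X i (Y i v) = Y i (X i v) + scale c v" and c: "c \<noteq> 0"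
    and nil: "\<And>i v. i < n \<Longrightarrow> (X i ^^ CHAR('a)) v = 0"
  shows "dim (UNIV :: 'b set) = CHAR('a) ^ n * dim {v. \<forall>i<n. X i v = 0}"
proof -
  define W where "W k = {v. \<forall>i<k. X i v = 0}" for k
  have "dim (UNIV :: 'b set) = CHAR('a) ^ k * dim (W k)" if "k \<le> n" for k
    using that
  proof (induction k)
    case 0
    thus ?case by (simp add: W_def)
  next
    case (Suc k)
    have lin: "X i (u + v) = X i u + X i v" "X i (scale a v) = scale a (X i v)" "X i 0 = 0"
      if "i < n" for i a u v
    proof -
      interpret Vector_Spaces.linear scale scale "X i" using X that by simp
      show "X i (u + v) = X i u + X i v" "X i (scale a v) = scale a (X i v)" "X i 0 = 0"
        by (rule add scale zero)+
    qed
    have "dim (W k) = CHAR('a) * dim {v \<in> W k. X k v = 0}"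
    proof (rule dim_weyl_pair[where Y = "Y k" and c = c])
      show "subspace (W k)" using Suc.prems by (auto simp: W_def subspace_def lin)
      show "X k v \<in> W k" if "v \<in> W k" for v
      proof -
        have "X i (X k v) = 0" if "i < k" for i
          using that Suc.prems XX[of i k v] \<open>v \<in> W k\<close> by (simp add: W_def lin)
        thus ?thesis by (simp add: W_def)
      qed
      show "Y k v \<in> W k" if "v \<in> W k" for v
      proof -
        have "X i (Y k v) = 0" if "i < k" for i
          using that Suc.prems XY[of i k v] \<open>v \<in> W k\<close> by (simp add: W_def Y0)
        thus ?thesis by (simp add: W_def)
      qed
    qed (use Suc.prems X Y0 rel c nil in auto)
    moreover have "{v \<in> W k. X k v = 0} = W (Suc k)"
      by (auto simp: W_def less_Suc_eq)
    ultimately show ?case using Suc by simp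
  qed
  thus ?thesis by (simp add: W_def)
qed

text \<open>
  The identity \<open>(X - a)\<^sup>p = X\<^sup>p - a\<^sup>p\<close> holds in the commutative ring of polynomials and is transported
  to operators by evaluating polynomials at \<open>X\<close>.
\<close>
lemma (in vector_space) funpow_minus_scale:
  assumes X: "Vector_Spaces.linear scale scale X"
    and p: "prime CHAR('a)" and pow: "\<And>v. (X ^^ CHAR('a)) v = scale (a ^ CHAR('a)) v"
  shows "((\<lambda>v. X v - scale a v) ^^ CHAR('a)) v = 0"
proof -
  interpret X: Vector_Spaces.linear scale scale X by (rule X)
  \<comment> \<open>\<open>ev n q\<close> is \<open>q(X)\<close> whenever \<open>degree q \<le> n\<close>.\<close>
  define ev where "ev n q v = (\<Sum>i\<le>n. scale (coeff q i) ((X ^^ i) v))" for n q v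
  define l where "l = [:-a, 1:]"
  have ev: "((\<lambda>v. X v - scale a v) ^^ n) v = ev n (l ^ n) v" for n
  proof (induction n)
    case 0
    show ?case by (simp add: ev_def)
  next
    case (Suc n)
    have deg: "coeff (l ^ n) (Suc n) = 0"
      by (rule coeff_eq_0) (simp add: l_def degree_power_eq)
    have c: "coeff (l ^ Suc n) i = (case i of 0 \<Rightarrow> 0 | Suc j \<Rightarrow> coeff (l ^ n) j) - a * coeff (l ^ n) i" for i
      by (simp add: l_def coeff_pCons split: nat.split)
    have "ev (Suc n) (l ^ Suc n) v =
      (\<Sum>i\<le>Suc n. scale (case i of 0 \<Rightarrow> 0 | Suc j \<Rightarrow> coeff (l ^ n) j) ((X ^^ i) v))
       - (\<Sum>i\<le>Suc n. scale (a * coeff (l ^ n) i) ((X ^^ i) v))"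
      by (simp only: ev_def c scale_left_diff_distrib sum_subtractf)
    also have "(\<Sum>i\<le>Suc n. scale (case i of 0 \<Rightarrow> 0 | Suc j \<Rightarrow> coeff (l ^ n) j) ((X ^^ i) v)) = X (ev n (l ^ n) v)"
      by (subst sum.atMost_Suc_shift) (simp add: ev_def X.sum X.scale)
    also have "(\<Sum>i\<le>Suc n. scale (a * coeff (l ^ n) i) ((X ^^ i) v)) = scale a (ev n (l ^ n) v)"
      by (simp add: deg ev_def scale_sum_right)
    finally show ?case using Suc by simp
  qed
  have "l = monom 1 1 + [:- a:]" by (simp add: l_def monom_altdef)
  hence lp: "l ^ CHAR('a) = monom 1 CHAR('a) + [:(- a) ^ CHAR('a):]"
    by (simp add: freshmans_dream p monom_power poly_const_pow)
  have "(- a) ^ CHAR('a) = - (a ^ CHAR('a))" using p minus_power_prime_CHAR by blast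
  hence c: "coeff (l ^ CHAR('a)) i = (if i = CHAR('a) then 1 else 0) - (if i = 0 then a ^ CHAR('a) else 0)" for i
    using lp prime_gt_0_nat[OF p] by (auto simp: coeff_pCons split: nat.split)
  have if_s: "scale (if P then x else 0) w = (if P then scale x w else 0)" for P x w by simp
  have "ev CHAR('a) (l ^ CHAR('a)) v = (X ^^ CHAR('a)) v - scale (a ^ CHAR('a)) v"
    by (simp add: ev_def c scale_left_diff_distrib sum_subtractf if_s)
  thus ?thesis using ev pow by simp
qed

section \<open>Linear conditions and commuting nilpotent operators\<close>

context vector_space begin

lemma dim_le_of_subset_span:
  assumes "S \<subseteq> T" "T \<subseteq> span F" "finite F"
  shows "dim S \<le> dim T"
proof -
  obtain B where B: "B \<subseteq> S" "independent B" "S \<subseteq> span B" "card B = dim S" by (rule basis_exists)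
  obtain C where C: "C \<subseteq> T" "independent C" "T \<subseteq> span C" "card C = dim T" by (rule basis_exists)
  have "finite C" using independent_span_bound[OF assms(3) C(2)] C(1) assms(2) by (meson order_trans)
  moreover have "B \<subseteq> span C" using B(1) assms(1) C(3) by (meson order_trans)
  ultimately have "card B \<le> card C" using independent_span_bound[OF _ B(2)] by blast
  thus ?thesis using B C by simp
qed

lemma dim_le_Suc_dim_kernel:
  assumes W: "subspace W" and fin: "W \<subseteq> span F" "finite F"
    and add: "\<And>x y. x \<in> W \<Longrightarrow> y \<in> W \<Longrightarrow> g (x + y) = g x + g y"
    and scale: "\<And>c x. x \<in> W \<Longrightarrow> g (scale c x) = c * g x"
  shows "dim W \<le> Suc (dim {x \<in> W. g x = 0})"
proof (cases "\<exists>v\<in>W. g v \<noteq> 0")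
  case False
  hence "{x \<in> W. g x = 0} = W" by blast
  thus ?thesis by simp
next
  case True
  then obtain v where v: "v \<in> W" "g v \<noteq> 0" by blast
  let ?K = "{x \<in> W. g x = 0}"
  obtain B where B: "B \<subseteq> ?K" "independent B" "?K \<subseteq> span B" "card B = dim ?K"
    by (rule basis_exists)
  have "B \<subseteq> span F" using B(1) fin(1) by blast
  hence finB: "finite B" using independent_span_bound[OF fin(2) B(2)] by blast
  have "W \<subseteq> span (insert v B)"
  proof
    fix w assume w: "w \<in> W"
    define c where "c = - (g w / g v)"
    have "scale c v \<in> W" using v W by (simp add: subspace_scale)
    hence "w + scale c v \<in> ?K" using w v W by (simp add: add scale subspace_add) (simp add: c_def)
    hence 1: "w + scale c v \<in> span (insert v B)" using B span_mono[of B "insert v B"] by blast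
    have "scale c v \<in> span (insert v B)" by (intro span_scale span_base) simp
    from span_diff[OF 1 this] show "w \<in> span (insert v B)" by simp
  qed
  hence "dim W \<le> card (insert v B)" using dim_le_card finB by blast
  also have "\<dots> \<le> Suc (card B)" using finB by (simp add: card_insert_if)
  finally show ?thesis using B by simp
qed

lemma dim_le_dim_kernels:
  assumes W: "subspace W" and fin: "W \<subseteq> span F" "finite F" and I: "finite I"
    and add: "\<And>i x y. i \<in> I \<Longrightarrow> x \<in> W \<Longrightarrow> y \<in> W \<Longrightarrow> g i (x + y) = g i x + g i y"
    and scale: "\<And>i c x. i \<in> I \<Longrightarrow> x \<in> W \<Longrightarrow> g i (scale c x) = c * g i x"
  shows "dim W \<le> dim {x \<in> W. \<forall>i\<in>I. g i x = 0} + card I"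
  using I add scale
proof (induction I rule: finite_induct)
  case empty
  show ?case by simp
next
  case (insert j I)
  let ?K = "{x \<in> W. \<forall>i\<in>I. g i x = 0}"
  have z: "g i 0 = 0" if "i \<in> I" for i
    using insert.prems(2)[of i 0 0] that W by (simp add: subspace_0)
  have K: "subspace ?K" using W insert.prems by (auto simp: subspace_def z)
  have "dim ?K \<le> Suc (dim {x \<in> ?K. g j x = 0})"
    by (rule dim_le_Suc_dim_kernel[OF K _ fin(2)]) (use fin insert.prems in auto)
  moreover have "{x \<in> ?K. g j x = 0} = {x \<in> W. \<forall>i\<in>insert j I. g i x = 0}" by auto
  moreover have "dim W \<le> dim ?K + card I" using insert by simp
  ultimately show ?case using insert.hyps by simp
qed

end

text \<open>
  The inductive step takes a common null vector of the other operators and applies the last nonvanishing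
  power of the new one to it.
\<close>
lemma common_kernel_of_commuting_nilpotents:
  fixes Ts :: "('v::zero \<Rightarrow> 'v) list"
  assumes ne: "(v :: 'v) \<noteq> 0"
    and zero: "\<And>T. T \<in> set Ts \<Longrightarrow> T 0 = 0"
    and comm: "\<And>S T v. S \<in> set Ts \<Longrightarrow> T \<in> set Ts \<Longrightarrow> S (T v) = T (S v)"
    and nil: "\<And>T v. T \<in> set Ts \<Longrightarrow> (T ^^ n) v = 0"
  shows "\<exists>w. w \<noteq> 0 \<and> (\<forall>T\<in>set Ts. T w = 0)"
  using zero comm nil
proof (induction Ts)
  case Nil
  thus ?case using ne by auto
next
  case (Cons T Ts)
  have "\<exists>w. w \<noteq> 0 \<and> (\<forall>S\<in>set Ts. S w = 0)"
    by (rule Cons.IH) (use Cons.prems in auto)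
  then obtain w where w: "w \<noteq> 0" "\<And>S. S \<in> set Ts \<Longrightarrow> S w = 0" by blast
  define k where "k = (LEAST k. (T ^^ k) w = 0)"
  have k: "(T ^^ k) w = 0"
    unfolding k_def by (rule LeastI[of _ n]) (simp add: Cons.prems(3))
  have k0: "k \<noteq> 0" using k w by (intro notI) simp
  then obtain j where j: "k = Suc j" by (cases k) auto
  have "(T ^^ j) w \<noteq> 0"
    using not_less_Least[of j "\<lambda>k. (T ^^ k) w = 0"] j by (simp add: k_def)
  moreover have "T ((T ^^ j) w) = 0" using k j by simp
  moreover have "S ((T ^^ j) w) = 0" if S: "S \<in> set Ts" for S
  proof -
    have "S ((T ^^ i) w) = (T ^^ i) (S w)" for i
      using Cons.prems(2)[of S T] S by (induction i) auto
    moreover have "(T ^^ i) 0 = 0" for i by (induction i) (simp_all add: Cons.prems(1))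
    ultimately show ?thesis using w(2)[OF S] by simp
  qed
  ultimately show ?case by auto
qed

section \<open>Modules over the reduced enveloping algebra as representations\<close>

lemma free_const_mult:
  "free_const c \<otimes>\<^bsub>free_alg X\<^esub> f = (\<lambda>w. c * f w)"
proof (rule ext)
  fix w
  have "(\<Sum>i\<le>length w. free_const c (take i w) * f (drop i w)) =
      (\<Sum>i\<le>length w. if i = 0 then c * f w else 0)"
    by (intro sum.cong refl) (auto simp: free_const_def)
  thus "(free_const c \<otimes>\<^bsub>free_alg X\<^esub> f) w = c * f w"
    by (simp add: free_alg_simps)
qed

lemma mult_free_const:
  "f \<otimes>\<^bsub>free_alg X\<^esub> free_const c = (\<lambda>w. f w * c)"
proof (rule ext)
  fix w
  have "(\<Sum>i\<le>length w. f (take i w) * free_const c (drop i w)) =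
      (\<Sum>i\<le>length w. if i = length w then f w * c else 0)"
    by (intro sum.cong refl) (auto simp: free_const_def)
  thus "(f \<otimes>\<^bsub>free_alg X\<^esub> free_const c) w = f w * c"
    by (simp add: free_alg_simps)
qed

lemma free_gen_mult:
  "free_gen x \<otimes>\<^bsub>free_alg X\<^esub> f = (\<lambda>w. case w of [] \<Rightarrow> 0 | y # u \<Rightarrow> if y = x then f u else 0)"
proof (rule ext)
  fix w
  have "(\<Sum>i\<le>length w. free_gen x (take i w) * f (drop i w)) =
      (\<Sum>i\<le>length w. if i = 1 then (case w of [] \<Rightarrow> 0 | y # u \<Rightarrow> if y = x then f u else 0) else 0)"
    by (intro sum.cong refl)
      (auto simp: free_gen_def take_Cons' split: list.split)
  thus "(free_gen x \<otimes>\<^bsub>free_alg X\<^esub> f) w = (case w of [] \<Rightarrow> 0 | y # u \<Rightarrow> if y = x then f u else 0)"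
    by (auto simp: free_alg_simps split: list.split)
qed

text \<open>
  Words are built by left multiplication with generators, and elements of the free algebra are finite
  sums of multiples of words.
\<close>
lemma free_alg_induct [consumes 1, case_names const add gen]:
  assumes f: "f \<in> carrier (free_alg X)"
    and const: "\<And>c. P (free_const c)"
    and add: "\<And>f g. f \<in> carrier (free_alg X) \<Longrightarrow> g \<in> carrier (free_alg X) \<Longrightarrow> P f \<Longrightarrow> P g \<Longrightarrow>
      P (f \<oplus>\<^bsub>free_alg X\<^esub> g)"
    and gen: "\<And>x f. x \<in> X \<Longrightarrow> f \<in> carrier (free_alg X) \<Longrightarrow> P f \<Longrightarrow>
      P (free_gen x \<otimes>\<^bsub>free_alg X\<^esub> f)"
  shows "P f"
proof -
  define mon where "mon u c = (\<lambda>w. if w = u then c else 0)" for u :: "'a list" and c :: 'b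
  have mon_closed: "mon u c \<in> carrier (free_alg X)" if "u \<in> lists X" for u c
  proof -
    have "{w. mon u c w \<noteq> 0} \<subseteq> {u}" by (auto simp: mon_def)
    thus ?thesis using that by (auto simp: free_alg_simps dest: finite_subset)
  qed
  have mon: "P (mon u c)" if "u \<in> lists X" for u c
    using that
  proof (induction u)
    case Nil
    have "mon [] c = free_const c" by (auto simp: mon_def free_const_def)
    thus ?case using const by simp
  next
    case (Cons x u)
    have "mon (x # u) c = free_gen x \<otimes>\<^bsub>free_alg X\<^esub> mon u c"
      by (auto simp: free_gen_mult mon_def split: list.split)
    thus ?case using gen[OF _ mon_closed] Cons by simp
  qed
  have "P f" if "finite S" "f \<in> carrier (free_alg X)" "{w. f w \<noteq> 0} = S" for S f
    using that
  proof (induction S arbitrary: f rule: finite_induct)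
    case empty
    hence "f = free_const 0" by (auto simp: free_const_def)
    thus ?case using const by simp
  next
    case (insert u S)
    let ?g = "f(u := 0)"
    have supp: "{w. ?g w \<noteq> 0} = S" using insert by auto
    have u: "u \<in> lists X" using insert.prems by (auto simp: free_alg_simps)
    have g: "?g \<in> carrier (free_alg X)"
      using insert.prems supp \<open>finite S\<close> by (auto simp: free_alg_simps)
    have "f = ?g \<oplus>\<^bsub>free_alg X\<^esub> mon u (f u)"
      by (auto simp: free_alg_simps mon_def)
    thus ?case using add[OF g mon_closed[OF u] insert.IH[OF g supp] mon[OF u]] by metis
  qed
  thus ?thesis using f by (auto simp: free_alg_simps)
qed

lemma (in left_module) act_zero_left: "act \<zero> v = 0"
  using act_add_left[of \<zero> \<zero> v] by simp

lemma (in left_module) act_minus_left: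
  "\<lbrakk>a \<in> carrier R; b \<in> carrier R\<rbrakk> \<Longrightarrow> act (a \<ominus> b) v = act a v - act b v"
  using act_add_left[of "a \<ominus> b" b v] by (simp add: minus_eq a_assoc l_neg)

text \<open>
  Modules over a quotient ring are pulled back along the projection. Applied twice, this turns a module
  over the reduced enveloping algebra into a module over the free algebra on which the relations of both
  quotients act by zero.
\<close>
locale quotient_module = ideal I S for I and S (structure) +
  fixes act :: "'a set \<Rightarrow> 'v::ab_group_add \<Rightarrow> 'v"
  assumes quot: "left_module (S Quot I) act"
begin

lemma pullback: "left_module S (\<lambda>a. act (I +> a))"
proof -
  interpret M: left_module "S Quot I" act by (rule quot)
  note h = ring_hom_memE[OF rcos_ring_hom]
  show ?thesis
    by unfold_locales (simp_all add: h M.act_add_left M.act_add_right M.act_mult M.act_one)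
qed

lemma pullback_zero: "a \<in> I \<Longrightarrow> act (I +> a) v = 0"
proof -
  interpret M: left_module "S Quot I" act by (rule quot)
  assume "a \<in> I"
  hence "I +> a = \<zero>\<^bsub>S Quot I\<^esub>" by (simp add: a_rcos_const FactRing_def)
  thus ?thesis by (simp only: M.act_zero_left)
qed

lemma quot_carrier: "carrier (S Quot I) = (+>) I ` carrier S"
  by (auto simp: FactRing_def A_RCOSETS_def')

end

text \<open>
  The operators \<open>rho x\<close> of a module over the reduced enveloping algebra satisfy the axioms of a
  representation with \<open>p\<close>-character \<open>\<chi>\<close>; together with \<open>is_submoduleI\<close> they
  translate statements about cosets of cosets of words into statements about operators.
\<close>
locale red_env_module = lie_carrier s br L
  for s :: "'k::field \<Rightarrow> 'l::ab_group_add \<Rightarrow> 'l" and br L +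
  fixes p :: nat and pm :: "'l \<Rightarrow> 'l" and chi :: "'l \<Rightarrow> 'k"
    and act :: "('l list \<Rightarrow> 'k) set set \<Rightarrow> 'v::ab_group_add \<Rightarrow> 'v"
  assumes pm_closed: "x \<in> L \<Longrightarrow> pm x \<in> L"
    and mod: "left_module (red_env_alg s br L p pm chi) act"
begin

definition red_gen :: "'l \<Rightarrow> ('l list \<Rightarrow> 'k) set set" where
  "red_gen x = red_ideal s br L p pm chi +>\<^bsub>env_alg s br L\<^esub> env_gen s br L x"

definition rho :: "'l \<Rightarrow> 'v \<Rightarrow> 'v" where "rho x = act (red_gen x)"

definition sc :: "'k \<Rightarrow> 'v \<Rightarrow> 'v" where "sc c = act (red_const s br L p pm chi c)"

definition actU :: "('l list \<Rightarrow> 'k) set \<Rightarrow> 'v \<Rightarrow> 'v" where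
  "actU u = act (red_ideal s br L p pm chi +>\<^bsub>env_alg s br L\<^esub> u)"

definition actF :: "('l list \<Rightarrow> 'k) \<Rightarrow> 'v \<Rightarrow> 'v" where
  "actF f = actU (env_ideal s br L +>\<^bsub>free_alg L\<^esub> f)"

sublocale Q: quotient_module "red_ideal s br L p pm chi" "env_alg s br L" act
  using ideal_red_ideal[OF pm_closed] mod
  by (simp add: quotient_module_def quotient_module_axioms_def red_env_alg_def)

sublocale U: left_module "env_alg s br L" actU
  using Q.pullback by (simp add: actU_def[abs_def])

sublocale QF: quotient_module "env_ideal s br L" "free_alg L" actU
  using ideal_env_ideal U.left_module_axioms
  by (simp add: quotient_module_def quotient_module_axioms_def env_alg_def)

sublocale F: left_module "free_alg L" actF
  using QF.pullback by (simp add: actF_def[abs_def])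

lemma rho_eq: "rho x = actF (free_gen x)" and sc_eq: "sc c = actF (free_const c)"
  by (simp_all add: rho_def sc_def red_gen_def red_const_def actF_def actU_def env_gen_def env_const_def)

lemmas closed_intros [simp, intro] = free_gen_closed free_const_closed add_closed s_closed br_closed

lemma actF_rel: "f \<in> env_rels s br L \<Longrightarrow> actF f v = 0"
proof -
  assume f: "f \<in> env_rels s br L"
  have "env_rels s br L \<subseteq> carrier (free_alg L)" by (auto simp: env_rels_def Let_def)
  hence "f \<in> env_ideal s br L" using QF.genideal_self f unfolding env_ideal_def by blast
  thus ?thesis unfolding actF_def by (rule QF.pullback_zero)
qed

lemma vector_space_sc: "vector_space sc"
proof
  fix a b :: 'k and v w
  have "free_const (a + b) = free_const a \<oplus>\<^bsub>free_alg L\<^esub> free_const b"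
    by (auto simp: free_const_def free_alg_simps)
  thus "sc (a + b) v = sc a v + sc b v" by (simp add: sc_eq F.act_add_left)
  have "free_const (a * b) = free_const a \<otimes>\<^bsub>free_alg L\<^esub> free_const b"
    unfolding free_const_mult by (auto simp: free_const_def)
  thus "sc a (sc b v) = sc (a * b) v" by (simp add: sc_eq F.act_mult)
  have "free_const (1 :: 'k) = \<one>\<^bsub>free_alg L\<^esub>" by (simp add: free_const_def free_alg_simps)
  thus "sc 1 v = v" by (simp only: sc_eq F.act_one)
  show "sc a (v + w) = sc a v + sc a w" by (simp add: sc_eq F.act_add_right)
qed

lemma rho_linear: "x \<in> L \<Longrightarrow> Vector_Spaces.linear sc sc (rho x)"
proof -
  assume x: "x \<in> L"
  interpret vector_space sc by (rule vector_space_sc)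
  have "free_const c \<otimes>\<^bsub>free_alg L\<^esub> free_gen x = free_gen x \<otimes>\<^bsub>free_alg L\<^esub> free_const c" for c :: 'k
    unfolding free_const_mult mult_free_const by (simp add: mult.commute)
  hence "rho x (sc c v) = sc c (rho x v)" for c v
    using x by (simp add: sc_eq rho_eq flip: F.act_mult)
  thus ?thesis
    using x by unfold_locales (simp_all add: rho_eq F.act_add_right)
qed

lemma rho_add:
  assumes "x \<in> L" "y \<in> L"
  shows "rho (x + y) v = rho x v + rho y v"
proof -
  have "free_gen (x + y) \<ominus>\<^bsub>free_alg L\<^esub> (free_gen x \<oplus>\<^bsub>free_alg L\<^esub> free_gen y) \<in> env_rels s br L"
    unfolding env_rels_def Let_def using assms by blast
  from actF_rel[OF this, of v] assms show ?thesis
    by (simp add: rho_eq F.act_minus_left F.act_add_left)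
qed

lemma rho_scale:
  assumes "x \<in> L"
  shows "rho (s c x) v = sc c (rho x v)"
proof -
  have "free_gen (s c x) \<ominus>\<^bsub>free_alg L\<^esub> (free_const c \<otimes>\<^bsub>free_alg L\<^esub> free_gen x) \<in> env_rels s br L"
    unfolding env_rels_def Let_def using assms by blast
  from actF_rel[OF this, of v] assms show ?thesis
    by (simp add: rho_eq sc_eq F.act_minus_left F.act_mult)
qed

lemma rho_bracket:
  assumes "x \<in> L" "y \<in> L"
  shows "rho (br x y) v = rho x (rho y v) - rho y (rho x v)"
proof -
  have "(free_gen x \<otimes>\<^bsub>free_alg L\<^esub> free_gen y \<ominus>\<^bsub>free_alg L\<^esub>
      free_gen y \<otimes>\<^bsub>free_alg L\<^esub> free_gen x) \<ominus>\<^bsub>free_alg L\<^esub> free_gen (br x y) \<in> env_rels s br L"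
    unfolding env_rels_def Let_def using assms by blast
  from actF_rel[OF this, of v] assms show ?thesis
    by (simp add: rho_eq F.act_minus_left F.act_mult)
qed

lemma rho_pow:
  assumes x: "x \<in> L"
  shows "(rho x ^^ p) v = rho (pm x) v + sc (chi x ^ p) v"
proof -
  let ?U = "env_alg s br L"
  have gen: "env_gen s br L y \<in> carrier ?U" if "y \<in> L" for y
    unfolding env_gen_def by (rule env_coset_closed[OF free_gen_closed[OF that]])
  have const: "env_const s br L c \<in> carrier ?U" for c
    unfolding env_const_def by (rule env_coset_closed[OF free_const_closed])
  let ?r = "(env_gen s br L x [^]\<^bsub>?U\<^esub> p \<ominus>\<^bsub>?U\<^esub> env_gen s br L (pm x)) \<ominus>\<^bsub>?U\<^esub> env_const s br L (chi x ^ p)"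
  have "red_rels s br L p pm chi \<subseteq> carrier ?U"
    using gen const pm_closed by (auto simp: red_rels_def Let_def)
  hence "red_rels s br L p pm chi \<subseteq> red_ideal s br L p pm chi"
    unfolding red_ideal_def by (rule Q.genideal_self)
  moreover have "?r \<in> red_rels s br L p pm chi" using x by (auto simp: red_rels_def Let_def)
  ultimately have "actU ?r v = 0" using Q.pullback_zero unfolding actU_def by blast
  moreover have "actU (env_gen s br L x [^]\<^bsub>?U\<^esub> n) v = (rho x ^^ n) v" for n
  proof (induction n arbitrary: v)
    case 0
    show ?case by (simp add: U.act_one)
  next
    case (Suc n)
    have "actU (env_gen s br L x [^]\<^bsub>?U\<^esub> Suc n) v = actU (env_gen s br L x [^]\<^bsub>?U\<^esub> n) (rho x v)"
      using gen[OF x] by (simp add: U.act_mult rho_eq actF_def env_gen_def)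
    thus ?case using Suc by (simp add: funpow_swap1)
  qed
  ultimately show ?thesis
    using gen[OF x] gen[OF pm_closed[OF x]] const[of "chi x ^ p"]
    by (simp add: U.act_minus_left rho_eq sc_eq actF_def env_gen_def env_const_def algebra_simps)
qed

lemma is_submoduleI:
  assumes "0 \<in> N" "\<And>v w. v \<in> N \<Longrightarrow> w \<in> N \<Longrightarrow> v + w \<in> N" "\<And>c v. v \<in> N \<Longrightarrow> sc c v \<in> N"
    and "\<And>x v. x \<in> L \<Longrightarrow> v \<in> N \<Longrightarrow> rho x v \<in> N"
  shows "is_submodule (red_env_alg s br L p pm chi) act N"
proof -
  have "\<forall>v\<in>N. actF f v \<in> N" if "f \<in> carrier (free_alg L)" for f
    using that
    by (induction rule: free_alg_induct)
      (use assms in \<open>auto simp: F.act_add_left F.act_mult simp flip: sc_eq rho_eq\<close>)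
  moreover have "\<exists>f\<in>carrier (free_alg L). act a = actF f" if "a \<in> carrier (red_env_alg s br L p pm chi)" for a
    using that Q.quot_carrier QF.quot_carrier
    by (auto simp: red_env_alg_def env_alg_def actF_def actU_def)
  ultimately show ?thesis
    unfolding is_submodule_def using assms(1,2) by metis
qed

end

section \<open>The current algebra\<close>

text \<open>
  The library operation \<open>*s\<close> on \<open>'k^2^2\<close> takes its scalars from \<open>'k^2\<close>, as the entries of such a vector are
  its rows.
\<close>
definition mat_scale :: "'k::field \<Rightarrow> 'k mat2 \<Rightarrow> 'k mat2" where
  "mat_scale c A = (\<chi> i j. c * A $ i $ j)"

definition comm :: "'k::field mat2 \<Rightarrow> 'k mat2 \<Rightarrow> 'k mat2" where
  "comm A B = A ** B - B ** A"

lemma cur_scale_monom: "cur_scale c (monom A i) = monom (mat_scale c A) i"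
  by (auto simp: poly_eq_iff coeff_cur_scale mat_scale_def vec_eq_iff)

lemmas mat2_simps = vec_eq_iff matrix_matrix_mult_def trace_def sum_2 forall_2 mat_scale_def
  comm_def mat_def

lemma comm_bilinear:
  "comm (A + B) C = comm A C + comm B C" "comm A (B + C) = comm A B + comm A C"
  "comm (mat_scale c A) B = mat_scale c (comm A B)" "comm A (mat_scale c B) = mat_scale c (comm A B)"
  by (simp_all add: mat2_simps algebra_simps)

lemma trace_comm [simp]: "trace (comm A B) = 0"
  by (simp add: mat2_simps algebra_simps)

lemma trace_lin [simp]: "trace (0 :: 'k::field mat2) = 0" "trace (mat_scale c A) = c * trace A"
  "trace (A + B :: 'k mat2) = trace A + trace B"
  by (simp_all add: mat2_simps algebra_simps)

lemma monom_in_cur_sl2: "i \<le> m \<Longrightarrow> trace A = 0 \<Longrightarrow> monom A i \<in> cur_sl2 m"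
  using degree_monom_le[of A i] by (simp add: cur_sl2_def)

lemma cur_bracket_monom:
  "i \<le> m \<Longrightarrow> j \<le> m \<Longrightarrow> cur_bracket m (monom A i) (monom B j) =
    (if i + j \<le> m then monom (comm A B) (i + j) else 0)"
  by (simp add: cur_bracket_eq cur_mult_monom comm_def diff_monom add.commute[of j i])

lemma cur_sl2_sum_monom: "u \<in> cur_sl2 m \<Longrightarrow> u = (\<Sum>i\<le>m. monom (coeff u i) i)"
  by (rule poly_as_sum_of_monoms'[symmetric]) (simp add: cur_sl2_def)

lemma coeff_cur_mult_convolution:
  assumes "n \<le> m"
  shows "coeff (cur_mult m u v) n = (\<Sum>i\<le>n. coeff u i ** coeff v (n - i))"
proof -
  have "(\<Sum>j\<le>m - i. if i + j = n then coeff u i ** coeff v j else 0) =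
      (if i \<le> n then coeff u i ** coeff v (n - i) else 0)" if "i \<le> m" for i
  proof (cases "i \<le> n")
    case True
    have "(\<Sum>j\<le>m - i. if i + j = n then coeff u i ** coeff v j else 0) =
        (\<Sum>j\<le>m - i. if j = n - i then coeff u i ** coeff v (n - i) else 0)"
      using True by (intro sum.cong) auto
    also have "\<dots> = coeff u i ** coeff v (n - i)"
      using True assms that by (subst sum.delta) auto
    finally show ?thesis using True by simp
  qed auto
  hence "coeff (cur_mult m u v) n = (\<Sum>i\<le>m. if i \<le> n then coeff u i ** coeff v (n - i) else 0)"
    by (simp add: coeff_cur_mult)
  also have "\<dots> = (\<Sum>i\<le>n. coeff u i ** coeff v (n - i))"
    using assms by (intro sum.mono_neutral_cong_right) auto
  finally show ?thesis .
qed

lemma trace_sum: "trace (sum f A :: 'k::field mat2) = (\<Sum>i\<in>A. trace (f i))"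
  by (induction A rule: infinite_finite_induct) simp_all

lemma mat2_mult_sum: "(A :: 'k::field mat2) ** sum f S = (\<Sum>i\<in>S. A ** f i)"
proof -
  have "A ** 0 = 0" by (simp add: mat2_simps)
  thus ?thesis by (induction S rule: infinite_finite_induct) (simp_all add: matrix_add_ldistrib)
qed

lemma trace_mult_mult_swap:
  fixes A B C :: "'k::field mat2"
  assumes "trace A = 0" "trace B = 0" "trace C = 0"
  shows "trace (A ** (B ** C)) = - trace (B ** (A ** C))"
proof -
  have "A $ 2 $ 2 = - A $ 1 $ 1" "B $ 2 $ 2 = - B $ 1 $ 1" "C $ 2 $ 2 = - C $ 1 $ 1"
    using assms by (auto simp: trace_def sum_2 add_eq_0_iff)
  thus ?thesis by (simp add: mat2_simps algebra_simps)
qed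

text \<open>
  For traceless \<open>2 \<times> 2\<close> matrices, \<open>u\<^sub>i u\<^sub>j + u\<^sub>j u\<^sub>i\<close> is a scalar matrix. Hence \<open>u\<^sup>2\<close> is a scalar over the ring of
  truncated polynomials, and multiplication by it preserves tracelessness; here this is read off from the
  antisymmetry in \<open>i\<close> and \<open>j\<close> of the traces of \<open>u\<^sub>i u\<^sub>j w\<^sub>k\<close>.
\<close>
lemma cur_mult_square_traceless:
  fixes u w :: "'k::field mat2 poly"
  assumes two: "(2 :: 'k) \<noteq> 0" and u: "\<And>i. trace (coeff u i) = 0" and w: "\<And>i. trace (coeff w i) = 0"
  shows "trace (coeff (cur_mult m u (cur_mult m u w)) n) = 0"
proof (cases "n \<le> m")
  case False
  thus ?thesis using degree_cur_mult[of m u "cur_mult m u w"] by (simp add: coeff_eq_0)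
next
  case True
  let ?t = "\<lambda>i j. trace (coeff u i ** (coeff u j ** coeff w (n - i - j)))"
  have "trace (coeff (cur_mult m u (cur_mult m u w)) n) = (\<Sum>i\<le>n. \<Sum>j\<le>n - i. ?t i j)"
    using True by (simp add: coeff_cur_mult_convolution trace_sum mat2_mult_sum)
  moreover have "(\<Sum>i\<le>n. \<Sum>j\<le>n - i. ?t i j) = (\<Sum>j\<le>n. \<Sum>i\<le>n - j. ?t i j)"
    by (simp add: sum.Sigma)
      (rule sum.reindex_bij_witness[of _ "\<lambda>(a, b). (b, a)" "\<lambda>(a, b). (b, a)"]; auto)
  moreover have "?t i j = - ?t j i" for i j
    using trace_mult_mult_swap[OF u u w, of i j "n - i - j"] by (simp only: diff_commute[of n j])
  hence "(\<Sum>j\<le>n. \<Sum>i\<le>n - j. ?t i j) = - (\<Sum>j\<le>n. \<Sum>i\<le>n - j. ?t j i)"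
    unfolding sum_negf[symmetric] by (intro sum.cong refl)
  ultimately have "trace (coeff (cur_mult m u (cur_mult m u w)) n) =
      - trace (coeff (cur_mult m u (cur_mult m u w)) n)" by simp
  hence "2 * trace (coeff (cur_mult m u (cur_mult m u w)) n) = 0"
    by (simp only: mult_2) (metis add.right_inverse)
  thus ?thesis using two by simp
qed

lemma cur_mult_one: "degree u \<le> m \<Longrightarrow> cur_mult m u (monom (mat 1) 0) = u"
proof -
  assume "degree u \<le> m"
  have "coeff (cur_mult m u (monom (mat 1) 0)) n = coeff u n" for n
  proof (cases "n \<le> m")
    case True
    have "(\<Sum>i\<le>n. coeff u i ** coeff (monom (mat 1) 0) (n - i)) = (\<Sum>i\<le>n. if i = n then coeff u n else 0)"
      by (intro sum.cong) (auto simp: matrix_mul_rid)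
    thus ?thesis using True by (simp add: coeff_cur_mult_convolution)
  next
    case False
    thus ?thesis using degree_cur_mult[of m u "monom (mat 1) 0"] \<open>degree u \<le> m\<close>
      by (simp add: coeff_eq_0)
  qed
  thus ?thesis by (simp add: poly_eq_iff)
qed

text \<open>
  The \<open>p\<close>-map takes values in the Lie algebra because an odd power of \<open>u\<close> is obtained from \<open>u\<close> by repeated
  multiplication with the scalar \<open>u\<^sup>2\<close>.
\<close>
lemma cur_pmap_closed:
  fixes u :: "'k::field mat2 poly"
  assumes "(2 :: 'k) \<noteq> 0" "odd p" "u \<in> cur_sl2 m"
  shows "cur_pmap m p u \<in> cur_sl2 m"
proof -
  have "(cur_mult m u ^^ (2 * k + 1)) (monom (mat 1) 0) \<in> cur_sl2 m" for k
  proof (induction k)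
    case 0
    show ?case using assms(3) by (simp add: cur_mult_one cur_sl2_def)
  next
    case (Suc k)
    let ?w = "(cur_mult m u ^^ (2 * k + 1)) (monom (mat 1) 0)"
    have "(cur_mult m u ^^ (2 * Suc k + 1)) (monom (mat 1) 0) = cur_mult m u (cur_mult m u ?w)"
      by simp
    moreover have "cur_mult m u (cur_mult m u ?w) \<in> cur_sl2 m"
      using Suc assms(3) cur_mult_square_traceless[OF assms(1), of u ?w m]
      by (auto simp: cur_sl2_def degree_cur_mult)
    ultimately show ?case by simp
  qed
  thus ?thesis using assms(2) by (auto simp: cur_pmap_def elim!: oddE)
qed

text \<open>
  An \<open>sl\<^sub>2\<close>-triple up to the normalization \<open>\<kappa>\<close> of \<open>[e, f]\<close>, with \<open>e\<close> nilpotent as a matrix. The factor \<open>\<kappa>\<close>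
  avoids denominators in \<open>sl2_basis_skew\<close>.
\<close>
definition sl2_basis :: "'k::field \<Rightarrow> 'k mat2 \<Rightarrow> 'k mat2 \<Rightarrow> 'k mat2 \<Rightarrow> bool" where
  "sl2_basis \<kappa> e h f \<longleftrightarrow> trace e = 0 \<and> trace h = 0 \<and> trace f = 0 \<and> e ** e = 0 \<and>
    comm h e = mat_scale 2 e \<and> comm h f = mat_scale (- 2) f \<and> comm e f = mat_scale \<kappa> h \<and>
    (\<forall>x. trace x = 0 \<longrightarrow> (\<exists>a b c. x = mat_scale a e + mat_scale b h + mat_scale c f))"

definition mat22 :: "'k \<Rightarrow> 'k \<Rightarrow> 'k \<Rightarrow> 'k \<Rightarrow> 'k::field mat2" where
  "mat22 a b c d = vector [vector [a, b], vector [c, d]]"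

lemma mat22_nth [simp]: "mat22 a b c d $ 1 $ 1 = a" "mat22 a b c d $ 1 $ 2 = b"
  "mat22 a b c d $ 2 $ 1 = c" "mat22 a b c d $ 2 $ 2 = d"
  by (simp_all add: mat22_def)

lemma sl2_basis_standard: "sl2_basis 1 (mat22 0 1 0 0) (mat22 1 0 0 (-1)) (mat22 0 0 1 0)"
  unfolding sl2_basis_def
proof (intro conjI allI impI)
  fix x :: "'a mat2" assume "trace x = 0"
  hence "x $ 2 $ 2 = - x $ 1 $ 1" by (simp add: trace_def sum_2 add_eq_0_iff)
  hence "x = mat_scale (x$1$2) (mat22 0 1 0 0) + mat_scale (x$1$1) (mat22 1 0 0 (-1))
      + mat_scale (x$2$1) (mat22 0 0 1 0)"
    by (simp add: mat2_simps)
  thus "\<exists>a b c. x = mat_scale a (mat22 0 1 0 0) + mat_scale b (mat22 1 0 0 (-1)) + mat_scale c (mat22 0 0 1 0)"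
    by blast
qed (simp_all add: mat2_simps)

lemma sl2_basis_opposite: "sl2_basis 1 (mat22 0 0 1 0) (mat22 (-1) 0 0 1) (mat22 0 1 0 0)"
  unfolding sl2_basis_def
proof (intro conjI allI impI)
  fix x :: "'a mat2" assume "trace x = 0"
  hence "x $ 2 $ 2 = - x $ 1 $ 1" by (simp add: trace_def sum_2 add_eq_0_iff)
  hence "x = mat_scale (x$2$1) (mat22 0 0 1 0) + mat_scale (- x$1$1) (mat22 (-1) 0 0 1)
      + mat_scale (x$1$2) (mat22 0 1 0 0)"
    by (simp add: mat2_simps)
  thus "\<exists>a b c. x = mat_scale a (mat22 0 0 1 0) + mat_scale b (mat22 (-1) 0 0 1) + mat_scale c (mat22 0 1 0 0)"
    by blast
qed (simp_all add: mat2_simps)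

text \<open>
  The nilpotent matrix in this basis has a nonzero component along the diagonal matrix \<open>diag(1, -1)\<close>,
  which reaches the linear forms that vanish on both off-diagonal matrix units.
\<close>
lemma sl2_basis_skew:
  assumes two: "(2 :: 'k::field) \<noteq> 0"
  shows "sl2_basis (4 :: 'k) (mat22 1 (-1) 1 (-1)) (mat22 0 1 1 0) (mat22 1 1 (-1) (-1))"
  unfolding sl2_basis_def
proof (intro conjI allI impI)
  fix x :: "'k mat2" assume "trace x = 0"
  hence x: "x $ 2 $ 2 = - x $ 1 $ 1" by (simp add: trace_def sum_2 add_eq_0_iff)
  \<comment> \<open>The coordinates of \<open>x\<close> solve \<open>a + c = x\<^sub>1\<^sub>1\<close>, \<open>b + (c - a) = x\<^sub>1\<^sub>2\<close>, \<open>b - (c - a) = x\<^sub>2\<^sub>1\<close>.\<close>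
  define r where "r = inverse (2 :: 'k)"
  have rr: "r + r = 1" using two by (simp add: r_def flip: mult_2)
  have sp: "z = r * z + r * z" for z using rr by (metis distrib_right mult_1)
  let ?a = "r * (x$1$1 - r * (x$1$2 - x$2$1))" and ?b = "r * (x$1$2 + x$2$1)"
    and ?c = "r * (x$1$1 + r * (x$1$2 - x$2$1))"
  have "?a + ?c = r * x$1$1 + r * x$1$1" by (simp add: algebra_simps)
  hence ac: "?a + ?c = x$1$1" using sp by metis
  have "?c - ?a = r * (r * (x$1$2 - x$2$1)) + r * (r * (x$1$2 - x$2$1))" by (simp add: algebra_simps)
  hence ca: "?c - ?a = r * (x$1$2 - x$2$1)" using sp by metis
  have "?b + (?c - ?a) = r * x$1$2 + r * x$1$2" unfolding ca by (simp add: algebra_simps)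
  hence bca: "?b + (?c - ?a) = x$1$2" using sp by metis
  have "?b - (?c - ?a) = r * x$2$1 + r * x$2$1" unfolding ca by (simp add: algebra_simps)
  hence bac: "?b - (?c - ?a) = x$2$1" using sp by metis
  have "x = mat_scale ?a (mat22 1 (-1) 1 (-1)) + mat_scale ?b (mat22 0 1 1 0)
      + mat_scale ?c (mat22 1 1 (-1) (-1))"
    unfolding vec_eq_iff forall_2 mat_scale_def vector_add_component vec_lambda_beta mat22_nth
    using ac bca bac x by (auto simp: algebra_simps)
  thus "\<exists>a b c. x = mat_scale a (mat22 1 (-1) 1 (-1)) + mat_scale b (mat22 0 1 1 0)
      + mat_scale c (mat22 1 1 (-1) (-1))"
    by blast
qed (simp_all add: mat2_simps)

text \<open>
  The three nilpotent matrices \<open>e\<close> of the preceding bases span \<open>sl\<^sub>2\<close>, so a nonzero linear form is nonzero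
  on one of them.
\<close>
lemma obtain_sl2_basis:
  fixes g :: "'k::field mat2 \<Rightarrow> 'k"
  assumes two: "(2 :: 'k) \<noteq> 0"
    and add: "\<And>A B. trace A = 0 \<Longrightarrow> trace B = 0 \<Longrightarrow> g (A + B) = g A + g B"
    and scale: "\<And>c A. trace A = 0 \<Longrightarrow> g (mat_scale c A) = c * g A"
    and x: "trace x = 0" "g x \<noteq> 0"
  obtains \<kappa> e h f where "sl2_basis \<kappa> e h f" "g e \<noteq> 0"
proof -
  let ?E = "mat22 0 1 0 0 :: 'k mat2" and ?H = "mat22 1 0 0 (-1) :: 'k mat2" and ?F = "mat22 0 0 1 0 :: 'k mat2"
  let ?N = "mat22 1 (-1) 1 (-1) :: 'k mat2"
  consider "g ?E \<noteq> 0" | "g ?F \<noteq> 0" | "g ?E = 0" "g ?F = 0" by blast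
  thus ?thesis
  proof cases
    case 1
    thus ?thesis using that sl2_basis_standard by blast
  next
    case 2
    thus ?thesis using that sl2_basis_opposite by blast
  next
    case 3
    have tr: "trace ?E = 0" "trace ?H = 0" "trace ?F = 0" by (simp_all add: trace_def sum_2)
    obtain a b c where "x = mat_scale a ?E + mat_scale b ?H + mat_scale c ?F"
      using sl2_basis_standard x unfolding sl2_basis_def by metis
    hence "g x = b * g ?H" using 3 tr by (simp add: add scale)
    hence "g ?H \<noteq> 0" using x by auto
    moreover have "?N = ?H + (mat_scale (-1) ?E + ?F)" by (simp add: mat2_simps)
    hence "g ?N = g ?H" using 3 tr by (simp add: add scale)
    ultimately show ?thesis using that sl2_basis_skew[OF two] by metis
  qed
qed

lemma coeff_cur_scale_mat_scale: "coeff (cur_scale c u) i = mat_scale c (coeff u i)"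
  by (simp add: coeff_cur_scale mat_scale_def)

lemma mat_scale_mat_scale: "mat_scale x (mat_scale y A) = mat_scale (x * y) A"
  by (simp add: mat2_simps mult.assoc)

lemma cur_bracket_comm:
  "cur_bracket m u v = (\<Sum>i\<le>m. \<Sum>j\<le>m - i. monom (comm (coeff u i) (coeff v j)) (i + j))"
  by (simp add: cur_bracket_def comm_def)

lemma cur_bracket_add:
  "cur_bracket m (u + v) w = cur_bracket m u w + cur_bracket m v w"
  "cur_bracket m w (u + v) = cur_bracket m w u + cur_bracket m w v"
  by (simp_all add: cur_bracket_comm comm_bilinear add_monom[symmetric] sum.distrib)

lemma cur_bracket_scale: "cur_bracket m (cur_scale c u) w = cur_scale c (cur_bracket m u w)"
proof -
  interpret vector_space "cur_scale :: 'a \<Rightarrow> _" by (rule vector_space_cur_scale)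
  show ?thesis
    by (simp add: cur_bracket_comm coeff_cur_scale_mat_scale comm_bilinear cur_scale_monom[symmetric]
        scale_sum_right)
qed

lemma cur_bracket_monom_right:
  assumes "k \<le> m"
  shows "cur_bracket m u (monom x k) = (\<Sum>i\<le>m - k. monom (comm (coeff u i) x) (i + k))"
proof -
  have c0: "comm A 0 = 0" for A :: "'a mat2" by (simp add: mat2_simps)
  have "(\<Sum>j\<le>m - i. monom (comm (coeff u i) (coeff (monom x k) j)) (i + j)) =
      (if i \<le> m - k then monom (comm (coeff u i) x) (i + k) else 0)" if "i \<le> m" for i
  proof -
    have "(\<Sum>j\<le>m - i. monom (comm (coeff u i) (coeff (monom x k) j)) (i + j)) =
        (\<Sum>j\<le>m - i. if k = j then monom (comm (coeff u i) x) (i + k) else 0)"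
      by (intro sum.cong) (auto simp: c0)
    also have "\<dots> = (if i \<le> m - k then monom (comm (coeff u i) x) (i + k) else 0)"
      using assms that by (subst sum.delta') auto
    finally show ?thesis .
  qed
  hence "cur_bracket m u (monom x k) = (\<Sum>i\<le>m. if i \<le> m - k then monom (comm (coeff u i) x) (i + k) else 0)"
    by (simp add: cur_bracket_comm)
  also have "\<dots> = (\<Sum>i\<le>m - k. monom (comm (coeff u i) x) (i + k))"
    by (intro sum.mono_neutral_cong_right) auto
  finally show ?thesis .
qed

section \<open>The codimension of the stabilizer\<close>

lemma fps_mult_nth_eq_0:
  assumes "\<And>n. n \<le> d \<Longrightarrow> fps_nth f n = 0" "n \<le> d"
  shows "fps_nth (g * f :: 'k::field fps) n = 0"
  using assms by (auto simp: fps_mult_nth intro!: sum.neutral)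

text \<open>
  Reversing \<open>\<alpha>, \<beta>, \<gamma>\<close> at \<open>d\<close> turns the sums into coefficients of products of power series modulo \<open>t\<^bsup>d+1\<^esup>\<close>:
  the hypotheses say \<open>2 b \<alpha> = \<kappa> c \<beta>\<close> and \<open>c \<gamma> = a \<alpha>\<close>, so that
  \<open>\<alpha> (\<kappa> a \<beta> - 2 b \<gamma>) = \<kappa> c \<gamma> \<beta> - \<kappa> c \<beta> \<gamma> = 0\<close>. The reversed \<open>\<alpha>\<close> is a unit, its constant term being \<open>\<alpha> d\<close>.
\<close>
lemma hankel_cross_relation:
  fixes a b c \<alpha> \<beta> \<gamma> :: "nat \<Rightarrow> 'k::field"
  assumes \<alpha>: "\<alpha> d \<noteq> 0"
    and 1: "\<And>k. k \<le> d \<Longrightarrow> (\<Sum>i\<le>d - k. 2 * b i * \<alpha> (i + k) - \<kappa> * c i * \<beta> (i + k)) = 0"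
    and 2: "\<And>k. k \<le> d \<Longrightarrow> (\<Sum>i\<le>d - k. c i * \<gamma> (i + k) - a i * \<alpha> (i + k)) = 0"
    and k: "k \<le> d"
  shows "(\<Sum>i\<le>d - k. \<kappa> * a i * \<beta> (i + k) - 2 * b i * \<gamma> (i + k)) = 0"
proof -
  define rv where "rv g = Abs_fps (\<lambda>n. if n \<le> d then g (d - n) else 0)" for g :: "nat \<Rightarrow> 'k"
  have conv: "fps_nth (Abs_fps x * rv g) (d - k) = (\<Sum>i\<le>d - k. x i * g (i + k))" if "k \<le> d" for x g k
    unfolding fps_mult_nth atMost_atLeast0 rv_def
    by (intro sum.cong) (use that in \<open>auto simp: Suc_diff_le add.commute\<close>)
  define A B C where "A = Abs_fps a" and "B = Abs_fps b" and "C = Abs_fps c"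
  define P where "P = fps_const 2 * (B * rv \<alpha>) - fps_const \<kappa> * (C * rv \<beta>)"
  define Q where "Q = C * rv \<gamma> - A * rv \<alpha>"
  define R where "R = fps_const \<kappa> * (A * rv \<beta>) - fps_const 2 * (B * rv \<gamma>)"
  have P: "fps_nth P n = 0" if "n \<le> d" for n
    using 1[of "d - n"] conv[of "d - n"] that
    by (simp add: P_def B_def C_def sum_subtractf mult.assoc flip: sum_distrib_left)
  have Q: "fps_nth Q n = 0" if "n \<le> d" for n
    using 2[of "d - n"] conv[of "d - n"] that
    by (simp add: Q_def A_def C_def sum_subtractf)
  have "rv \<alpha> * R = - (fps_const \<kappa> * rv \<beta> * Q + rv \<gamma> * P)"
    by (simp add: P_def Q_def R_def algebra_simps)
  hence Z: "fps_nth (rv \<alpha> * R) n = 0" if "n \<le> d" for n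
    using fps_mult_nth_eq_0[of d P, OF P that] fps_mult_nth_eq_0[of d Q, OF Q that]
    by (simp only: fps_neg_nth fps_add_nth) simp
  hence "fps_nth (inverse (rv \<alpha>) * (rv \<alpha> * R)) (d - k) = 0"
    using fps_mult_nth_eq_0[of d "rv \<alpha> * R", OF Z, of "d - k"] by simp
  moreover have "inverse (rv \<alpha>) * rv \<alpha> = 1"
    using \<alpha> by (intro inverse_mult_eq_1) (simp add: rv_def)
  ultimately have "fps_nth R (d - k) = 0" by (simp flip: mult.assoc)
  thus ?thesis using conv[OF k]
    by (simp add: R_def A_def B_def sum_subtractf mult.assoc flip: sum_distrib_left)
qed

locale current_form =
  fixes m :: nat and chi :: "'k::field mat2 poly \<Rightarrow> 'k"
  assumes chi: "chi \<in> lie_dual cur_scale (cur_sl2 m)" and two: "(2 :: 'k) \<noteq> 0"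
begin

lemma chi_add: "u \<in> cur_sl2 m \<Longrightarrow> v \<in> cur_sl2 m \<Longrightarrow> chi (u + v) = chi u + chi v"
  and chi_scale: "u \<in> cur_sl2 m \<Longrightarrow> chi (cur_scale c u) = c * chi u"
  using chi by (auto simp: lie_dual_def)

lemma zero_in_cur_sl2: "0 \<in> cur_sl2 m"
  by (simp add: cur_sl2_def)

lemma chi_zero: "chi 0 = 0"
  using chi_scale[OF zero_in_cur_sl2, of 0] by (simp add: cur_scale_def)

lemma chi_sum:
  assumes "\<And>i. i \<in> I \<Longrightarrow> f i \<in> cur_sl2 m"
  shows "chi (sum f I) = (\<Sum>i\<in>I. chi (f i))"
proof -
  interpret lie_carrier cur_scale "cur_bracket m" "cur_sl2 m :: 'k mat2 poly set"
    by (rule lie_carrier_cur_sl2)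
  have "sum f I \<in> cur_sl2 m \<and> chi (sum f I) = (\<Sum>i\<in>I. chi (f i))"
    using assms
    by (induction I rule: infinite_finite_induct) (auto simp: zero_in_cur_sl2 chi_zero chi_add add_closed)
  thus ?thesis by blast
qed

lemma chi_monom_add: "n \<le> m \<Longrightarrow> trace A = 0 \<Longrightarrow> trace B = 0 \<Longrightarrow>
    chi (monom (A + B) n) = chi (monom A n) + chi (monom B n)"
  by (simp add: add_monom[symmetric] chi_add monom_in_cur_sl2)

lemma chi_monom_scale: "n \<le> m \<Longrightarrow> trace A = 0 \<Longrightarrow> chi (monom (mat_scale c A) n) = c * chi (monom A n)"
  by (simp add: cur_scale_monom[symmetric] chi_scale monom_in_cur_sl2)

lemma chi_bracket_monom:
  assumes "k \<le> m"
  shows "chi (cur_bracket m u (monom x k)) = (\<Sum>i\<le>m - k. chi (monom (comm (coeff u i) x) (i + k)))"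
  unfolding cur_bracket_monom_right[OF assms]
  using assms by (intro chi_sum) (simp add: monom_in_cur_sl2)

lemma chi_bracket_monom_lin:
  assumes "k \<le> m"
  shows "chi (cur_bracket m u (monom (x + y) k)) =
      chi (cur_bracket m u (monom x k)) + chi (cur_bracket m u (monom y k))"
    and "chi (cur_bracket m u (monom (mat_scale c x) k)) = c * chi (cur_bracket m u (monom x k))"
  using assms
  by (simp_all add: chi_bracket_monom comm_bilinear chi_monom_add chi_monom_scale sum.distrib sum_distrib_left)

text \<open>
  With the coordinates \<open>a, b, c\<close> of \<open>u\<close> and the values \<open>\<alpha>, \<beta>, \<gamma>\<close> of \<open>\<chi>\<close> along \<open>e, h, f\<close>, the conditions
  \<open>\<chi>([u, e t\<^sup>k]) = 0\<close> and \<open>\<chi>([u, h t\<^sup>k]) = 0\<close> are the hypotheses of \<open>hankel_cross_relation\<close>, and its conclusion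
  is \<open>\<chi>([u, f t\<^sup>k]) = 0\<close>.
\<close>
lemma in_stab_of_two_rows:
  assumes basis: "sl2_basis \<kappa> e h f"
    and d: "d \<le> m" and top: "\<And>i A. d < i \<Longrightarrow> i \<le> m \<Longrightarrow> trace A = 0 \<Longrightarrow> chi (monom A i) = 0"
    and e: "chi (monom e d) \<noteq> 0"
    and u: "u \<in> cur_sl2 m"
    and rows: "\<And>k. k \<le> d \<Longrightarrow> chi (cur_bracket m u (monom e k)) = 0"
      "\<And>k. k \<le> d \<Longrightarrow> chi (cur_bracket m u (monom h k)) = 0"
  shows "u \<in> lie_stab (cur_bracket m) (cur_sl2 m) chi"
proof -
  note b = basis[unfolded sl2_basis_def]
  have tr: "trace e = 0" "trace h = 0" "trace f = 0" using b by auto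
  have "\<exists>a b c. coeff u i = mat_scale a e + mat_scale b h + mat_scale c f" for i
    using b u by (auto simp: cur_sl2_def)
  then obtain a b c where co: "\<And>i. coeff u i = mat_scale (a i) e + mat_scale (b i) h + mat_scale (c i) f"
    by metis
  have self: "comm A A = 0" and anti: "comm A B = mat_scale (- 1) (comm B A)" for A B :: "'k mat2"
    by (simp_all add: mat2_simps)
  have eh: "comm e h = mat_scale (- 2) e" "comm f h = mat_scale 2 f" "comm f e = mat_scale (- \<kappa>) h"
    "comm h e = mat_scale 2 e" "comm h f = mat_scale (- 2) f" "comm e f = mat_scale \<kappa> h"
    "comm e e = 0" "comm h h = 0" "comm f f = 0"
    using b anti[of e h] anti[of f h] anti[of f e] by (simp_all add: self mat_scale_mat_scale)
  have z: "chi (monom 0 n) = 0" for n by (simp add: chi_zero)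
  have row: "chi (cur_bracket m u (monom x k)) = (\<Sum>i\<le>d - k. chi (monom (comm (coeff u i) x) (i + k)))"
    if "k \<le> d" for x k
  proof -
    have "chi (monom (comm (coeff u i) x) (i + k)) = 0" if "i \<in> {..m - k} - {..d - k}" for i
      by (rule top) (use that \<open>k \<le> d\<close> d in auto)
    thus ?thesis
      unfolding chi_bracket_monom[OF order.trans[OF that d]]
      using that d by (intro sum.mono_neutral_right) auto
  qed
  note lin = comm_bilinear chi_monom_add chi_monom_scale tr eh z mat_scale_def[of 0]
  define \<alpha> \<beta> \<gamma> where "\<alpha> n = chi (monom e n)" and "\<beta> n = chi (monom h n)" and "\<gamma> n = chi (monom f n)" for n
  have s0: "mat_scale x 0 = 0" for x :: 'k by (simp add: mat2_simps)
  have terms: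
    "chi (monom (comm (coeff u i) e) n) = 2 * b i * \<alpha> n - \<kappa> * c i * \<beta> n"
    "chi (monom (comm (coeff u i) h) n) = 2 * (c i * \<gamma> n - a i * \<alpha> n)"
    "chi (monom (comm (coeff u i) f) n) = \<kappa> * a i * \<beta> n - 2 * b i * \<gamma> n" if "n \<le> m" for i n
    using that by (simp_all add: co lin s0 \<alpha>_def \<beta>_def \<gamma>_def algebra_simps)
  have f: "chi (cur_bracket m u (monom f k)) = 0" if k: "k \<le> d" for k
  proof -
    have "(\<Sum>i\<le>d - k. \<kappa> * a i * \<beta> (i + k) - 2 * b i * \<gamma> (i + k)) = 0"
    proof (rule hankel_cross_relation[OF _ _ _ k])
      show "\<alpha> d \<noteq> 0" using e by (simp add: \<alpha>_def)
      fix k assume k: "k \<le> d"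
      have "(\<Sum>i\<le>d - k. 2 * b i * \<alpha> (i + k) - \<kappa> * c i * \<beta> (i + k)) =
          (\<Sum>i\<le>d - k. chi (monom (comm (coeff u i) e) (i + k)))"
        using k d by (intro sum.cong) (auto simp: terms)
      thus "(\<Sum>i\<le>d - k. 2 * b i * \<alpha> (i + k) - \<kappa> * c i * \<beta> (i + k)) = 0"
        using row[OF k] rows(1)[OF k] by simp
      have "2 * (\<Sum>i\<le>d - k. c i * \<gamma> (i + k) - a i * \<alpha> (i + k)) =
          (\<Sum>i\<le>d - k. chi (monom (comm (coeff u i) h) (i + k)))"
        unfolding sum_distrib_left using k d by (intro sum.cong) (auto simp: terms)
      thus "(\<Sum>i\<le>d - k. c i * \<gamma> (i + k) - a i * \<alpha> (i + k)) = 0"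
        using row[OF k] rows(2)[OF k] two by simp
    qed
    moreover have "(\<Sum>i\<le>d - k. \<kappa> * a i * \<beta> (i + k) - 2 * b i * \<gamma> (i + k)) =
        (\<Sum>i\<le>d - k. chi (monom (comm (coeff u i) f) (i + k)))"
      using k d by (intro sum.cong) (auto simp: terms)
    ultimately show ?thesis using row[OF k] by simp
  qed
  have mon: "chi (cur_bracket m u (monom x k)) = 0" if k: "k \<le> m" and x: "trace x = 0" for x k
  proof (cases "k \<le> d")
    case True
    obtain a' b' c' where "x = mat_scale a' e + mat_scale b' h + mat_scale c' f"
      using b x by metis
    thus ?thesis using rows f True k by (simp add: chi_bracket_monom_lin)
  next
    case False
    thus ?thesis unfolding chi_bracket_monom[OF k] using k by (intro sum.neutral ballI top) auto
  qed
  have "chi (cur_bracket m u y) = 0" if y: "y \<in> cur_sl2 m" for y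
  proof -
    have sum: "cur_bracket m u (sum g I) = (\<Sum>i\<in>I. cur_bracket m u (g i))" for g :: "nat \<Rightarrow> _" and I
    proof -
      have "cur_bracket m u 0 = 0" using cur_bracket_add(2)[of m u 0 0] by simp
      thus ?thesis by (induction I rule: infinite_finite_induct) (simp_all add: cur_bracket_add)
    qed
    interpret lie_carrier cur_scale "cur_bracket m" "cur_sl2 m :: 'k mat2 poly set"
      by (rule lie_carrier_cur_sl2)
    have "chi (cur_bracket m u y) = chi (cur_bracket m u (\<Sum>k\<le>m. monom (coeff y k) k))"
      using cur_sl2_sum_monom[OF y] by simp
    also have "\<dots> = (\<Sum>k\<le>m. chi (cur_bracket m u (monom (coeff y k) k)))"
      unfolding sum using y by (intro chi_sum br_closed u monom_in_cur_sl2) (auto simp: cur_sl2_def)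
    also have "\<dots> = 0" using y by (intro sum.neutral) (auto simp: mon cur_sl2_def)
    finally show ?thesis .
  qed
  thus ?thesis using u by (simp add: lie_stab_def)
qed

lemma codim_lie_stab_le:
  assumes basis: "sl2_basis \<kappa> e h f"
    and d: "d \<le> m" and top: "\<And>i A. d < i \<Longrightarrow> i \<le> m \<Longrightarrow> trace A = 0 \<Longrightarrow> chi (monom A i) = 0"
    and e: "chi (monom e d) \<noteq> 0"
  shows "vector_space.dim cur_scale (cur_sl2 m :: 'k mat2 poly set)
     - vector_space.dim cur_scale (lie_stab (cur_bracket m) (cur_sl2 m) chi) \<le> 2 * (d + 1)"
proof -
  interpret V: vector_space "cur_scale :: 'k \<Rightarrow> _" by (rule vector_space_cur_scale)
  interpret lie_carrier cur_scale "cur_bracket m" "cur_sl2 m :: 'k mat2 poly set"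
    by (rule lie_carrier_cur_sl2)
  let ?L = "cur_sl2 m :: 'k mat2 poly set" and ?S = "lie_stab (cur_bracket m) (cur_sl2 m) chi"
  obtain B where B: "B \<subseteq> ?L" "V.independent B" "?L \<subseteq> V.span B" "card B = V.dim ?L"
    by (rule V.basis_exists)
  show ?thesis
  proof (cases "finite B")
    case False
    \<comment> \<open>The dimension of a space with an infinite basis is \<open>0\<close> by convention.\<close>
    thus ?thesis using B(4) by simp
  next
    case True
    define x where "x b = (if b then e else h)" for b
    have tr: "trace (x b) = 0" for b using basis by (simp add: x_def sl2_basis_def)
    define g where "g i u = chi (cur_bracket m u (monom (x (snd i)) (fst i)))" for i :: "nat \<times> bool" and u
    let ?I = "{..d} \<times> (UNIV :: bool set)"
    let ?K = "{u \<in> ?L. \<forall>i\<in>?I. g i u = 0}"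
    have L: "V.subspace ?L"
      unfolding V.subspace_def by (auto simp: zero_in_cur_sl2 add_closed s_closed)
    have xL: "monom (x b) k \<in> ?L" if "k \<le> d" for b k
      using that d by (intro monom_in_cur_sl2 tr) simp
    have "V.dim ?L \<le> V.dim ?K + card ?I"
    proof (rule V.dim_le_dim_kernels[OF L B(3) True])
      fix i u v c assume i: "i \<in> ?I" and u: "u \<in> ?L"
      show "g i (cur_scale c u) = c * g i u"
        using i u by (auto simp: g_def cur_bracket_scale chi_scale br_closed xL)
      assume v: "v \<in> ?L"
      show "g i (u + v) = g i u + g i v"
        using i u v by (auto simp: g_def cur_bracket_add chi_add br_closed xL)
    qed simp
    moreover have "?K \<subseteq> ?S"
    proof
      fix u assume u: "u \<in> ?K"
      have "g (k, b) u = 0" if "k \<le> d" for k b using u that by auto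
      from this[of _ True] this[of _ False]
      show "u \<in> ?S"
        using u by (intro in_stab_of_two_rows[OF basis d top e]) (auto simp: g_def x_def)
    qed
    hence "V.dim ?K \<le> V.dim ?S"
      by (rule V.dim_le_of_subset_span[OF _ _ True]) (use B(3) in \<open>auto simp: lie_stab_def\<close>)
    moreover have "card ?I = 2 * (d + 1)" by simp
    ultimately show ?thesis by linarith
  qed
qed

end

section \<open>The dimension of a simple module\<close>

locale current_sl2_module = current_form m chi +
  red_env_module cur_scale "cur_bracket m" "cur_sl2 m" p "cur_pmap m p" chi act
  for m p :: nat and chi :: "'k::field mat2 poly \<Rightarrow> 'k"
    and act :: "('k mat2 poly list \<Rightarrow> 'k) set set \<Rightarrow> 'v::ab_group_add \<Rightarrow> 'v" +
  assumes p_char: "p = CHAR('k)" and p_gt_2: "p > 2"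
    and simple: "simple_module (sl2_red_env m p chi) act"
begin

sublocale V: vector_space sc
  by (rule vector_space_sc)

lemma prime_p: "prime p"
  using prime_CHAR_semidom[where ?'a = 'k] p_gt_2 unfolding p_char by simp

lemma rho_zero_vec: "x \<in> cur_sl2 m \<Longrightarrow> rho x 0 = 0"
  and rho_add_vec: "x \<in> cur_sl2 m \<Longrightarrow> rho x (v + w) = rho x v + rho x w"
  and rho_scale_vec: "x \<in> cur_sl2 m \<Longrightarrow> rho x (sc c v) = sc c (rho x v)"
  and rho_diff_vec: "x \<in> cur_sl2 m \<Longrightarrow> rho x (v - w) = rho x v - rho x w"
proof -
  assume x: "x \<in> cur_sl2 m"
  interpret Vector_Spaces.linear sc sc "rho x" by (rule rho_linear[OF x])
  show "rho x 0 = 0" "rho x (v + w) = rho x v + rho x w" "rho x (sc c v) = sc c (rho x v)"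
    "rho x (v - w) = rho x v - rho x w"
    by (rule zero add scale diff)+
qed

lemma rho_zero: "rho 0 v = 0"
  using rho_scale[OF zero_in_cur_sl2, of 0 v] by (simp add: cur_scale_def)

lemma rho_sum:
  assumes "\<And>i. i \<in> I \<Longrightarrow> f i \<in> cur_sl2 m"
  shows "rho (sum f I) v = (\<Sum>i\<in>I. rho (f i) v)"
proof -
  have "sum f I \<in> cur_sl2 m \<and> rho (sum f I) v = (\<Sum>i\<in>I. rho (f i) v)"
    using assms
    by (induction I rule: infinite_finite_induct) (auto simp: zero_in_cur_sl2 rho_zero rho_add)
  thus ?thesis by blast
qed

lemma rho_monom_commute:
  assumes "i \<le> m" "j \<le> m" "trace A = 0" "trace B = 0"
  shows "rho (monom A i) (rho (monom B j) v) = rho (monom B j) (rho (monom A i) v) +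
    (if i + j \<le> m then rho (monom (comm A B) (i + j)) v else 0)"
  using rho_bracket[of "monom A i" "monom B j" v] assms
  by (auto simp: monom_in_cur_sl2 cur_bracket_monom rho_zero algebra_simps split: if_splits)

lemma rho_monom_pow:
  assumes "i \<le> m" "trace A = 0"
  shows "(rho (monom A i) ^^ p) v =
    (if p * i \<le> m then rho (monom (mat_pow A p) (p * i)) v else 0) + sc (chi (monom A i) ^ p) v"
  using rho_pow[of "monom A i" v] assms
  by (simp add: monom_in_cur_sl2 cur_pmap_monom rho_zero)

lemma trace_mat_pow: "trace (A :: 'k mat2) = 0 \<Longrightarrow> trace (mat_pow A p) = 0"
proof -
  assume "trace A = 0"
  hence "cur_pmap m p (monom A 0) \<in> cur_sl2 m" by (intro pm_closed monom_in_cur_sl2) simp_all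
  hence "monom (mat_pow A p) 0 \<in> cur_sl2 m" by (simp add: cur_pmap_monom)
  hence "trace (coeff (monom (mat_pow A p) 0) 0) = 0" unfolding cur_sl2_def by blast
  thus ?thesis by simp
qed

lemma invariant_subset_trivial:
  assumes "0 \<in> N" "\<And>v w. v \<in> N \<Longrightarrow> w \<in> N \<Longrightarrow> v + w \<in> N" "\<And>c v. v \<in> N \<Longrightarrow> sc c v \<in> N"
    and mon: "\<And>A i v. i \<le> m \<Longrightarrow> trace A = 0 \<Longrightarrow> v \<in> N \<Longrightarrow> rho (monom A i) v \<in> N"
    and "v \<in> N" "v \<noteq> 0"
  shows "w \<in> N"
proof -
  have "rho x u \<in> N" if x: "x \<in> cur_sl2 m" and u: "u \<in> N" for x u
  proof -
    have tr: "trace (coeff x i) = 0" for i using x by (simp add: cur_sl2_def)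
    have "rho x u = rho (\<Sum>i\<le>m. monom (coeff x i) i) u"
      using cur_sl2_sum_monom[OF x] by simp
    also have "\<dots> = (\<Sum>i\<le>m. rho (monom (coeff x i) i) u)"
      by (intro rho_sum monom_in_cur_sl2 tr) simp
    also have "(\<Sum>i\<in>I. rho (monom (coeff x i) i) u) \<in> N" if "I \<subseteq> {..m}" for I
      using finite_subset[OF that] that
      by (induction I rule: finite_induct) (use assms(1,2) mon[OF _ tr u] in auto)
    finally show ?thesis by simp
  qed
  hence "is_submodule (sl2_red_env m p chi) act N"
    unfolding sl2_red_env_def using assms by (intro is_submoduleI) auto
  thus ?thesis using simple assms(5,6) unfolding simple_module_def by blast
qed

text \<open>
  Downward induction on the degree \<open>i\<close>. Once all higher degrees act by zero, the operators of degree \<open>i\<close>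
  commute, because \<open>2i > i\<close>, and have \<open>p\<close>-th power zero, because the \<open>p\<close>-map lands in degree \<open>p i > i\<close> and
  \<open>\<chi>\<close> vanishes in degree \<open>i\<close>. So they have a common null vector. The common kernel is stable under the Lie
  algebra, since brackets do not lower degrees, and it is the whole module by simplicity.
\<close>
lemma rho_monom_eq_0_above:
  assumes top: "\<And>i A. d < i \<Longrightarrow> i \<le> m \<Longrightarrow> trace A = 0 \<Longrightarrow> chi (monom A i) = 0"
    and "d < i" "i \<le> m" "trace A = 0"
  shows "rho (monom A i) v = 0"
  using assms(2-)
proof (induction "m - i" arbitrary: i A v rule: less_induct)
  case less
  have above: "rho (monom B j) v = 0" if "i < j" "j \<le> m" "trace B = 0" for B j v
    using less.hyps[of j B v] that less.prems by simp
  have commute: "rho (monom B i) (rho (monom C i) v) = rho (monom C i) (rho (monom B i) v)"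
    if "trace B = 0" "trace C = 0" for B C v
    using less.prems that by (simp add: rho_monom_commute[of i i B C] above)
  have nil: "(rho (monom B i) ^^ p) v = 0" if B: "trace B = 0" for B v
  proof -
    have "i < p * i" using p_gt_2 less.prems n_less_m_mult_n[of i p] by simp
    moreover have "0 < p" using p_gt_2 by simp
    ultimately show ?thesis
      using less.prems B by (simp add: rho_monom_pow above trace_mat_pow top)
  qed
  define E H F where "E = (mat22 0 1 0 0 :: 'k mat2)" and "H = (mat22 1 0 0 (-1) :: 'k mat2)"
    and "F = (mat22 0 0 1 0 :: 'k mat2)"
  have tr: "trace E = 0" "trace H = 0" "trace F = 0"
    using sl2_basis_standard unfolding sl2_basis_def E_def H_def F_def by blast+
  obtain v0 :: 'v where "v0 \<noteq> 0" using simple unfolding simple_module_def by blast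
  hence "\<exists>w. w \<noteq> 0 \<and> (\<forall>T\<in>set (map (\<lambda>B. rho (monom B i)) [E, H, F]). T w = 0)"
    by (rule common_kernel_of_commuting_nilpotents[where n = p])
      (use less.prems tr nil commute in \<open>auto simp: rho_zero_vec monom_in_cur_sl2\<close>)
  then obtain w where w: "w \<noteq> 0" "rho (monom E i) w = 0" "rho (monom H i) w = 0" "rho (monom F i) w = 0"
    by auto
  let ?N = "{v. \<forall>B. trace B = 0 \<longrightarrow> rho (monom B i) v = 0}"
  have "v \<in> ?N"
  proof (rule invariant_subset_trivial)
    show "w \<in> ?N"
    proof (intro CollectI allI impI)
      fix B :: "'k mat2" assume "trace B = 0"
      then obtain a b c where "B = mat_scale a E + mat_scale b H + mat_scale c F"
        using sl2_basis_standard unfolding sl2_basis_def E_def H_def F_def by metis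
      hence B: "monom B i = cur_scale a (monom E i) + cur_scale b (monom H i) + cur_scale c (monom F i)"
        by (simp add: cur_scale_monom add_monom)
      have "monom E i \<in> cur_sl2 m" "monom H i \<in> cur_sl2 m" "monom F i \<in> cur_sl2 m"
        using tr less.prems by (auto intro: monom_in_cur_sl2)
      thus "rho (monom B i) w = 0" unfolding B using w by (simp add: rho_add rho_scale)
    qed
    fix A :: "'k mat2" and j v assume j: "j \<le> m" and A: "trace A = 0" and v: "v \<in> ?N"
    have "rho (monom B i) (rho (monom A j) v) = 0" if B: "trace B = 0" for B
    proof -
      have "rho (monom (comm B A) (i + j)) v = 0" if "i + j \<le> m"
      proof (cases "j = 0")
        case True
        thus ?thesis using v by simp
      next
        case False
        thus ?thesis using that by (intro above) auto
      qed
      thus ?thesis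
        using less.prems A B j v by (simp add: rho_monom_commute[of i j B A] rho_zero_vec monom_in_cur_sl2)
    qed
    thus "rho (monom A j) v \<in> ?N" by simp
  qed (use w less.prems in \<open>auto simp: rho_zero_vec rho_add_vec rho_scale_vec monom_in_cur_sl2\<close>)
  thus ?case using less.prems by blast
qed

lemma mat_pow_eq_0: "e ** e = 0 \<Longrightarrow> mat_pow e p = 0"
proof -
  assume e: "e ** e = 0"
  obtain k where k: "p = Suc (Suc k)" using p_gt_2 by (metis less_imp_Suc_add add_2_eq_Suc)
  have "mat_pow e p = e ** e ** mat_pow e k"
    by (simp add: mat_pow_def k matrix_mul_assoc)
  thus ?thesis using e by (simp add: mat2_simps)
qed

text \<open>
  Multiplying \<open>h t\<^sup>i\<close> by \<open>(e t\<^sup>d)\<^bsup>p-1\<^esup>\<close> replaces the commutator \<open>-2 e t\<^sup>d\<close>, which is merely invertible, by the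
  scalar \<open>-2 (e t\<^sup>d)\<^sup>p\<close>, as \<open>dim_weyl_system\<close> requires.
\<close>
lemma power_dvd_dim:
  assumes basis: "sl2_basis \<kappa> e h f"
    and d: "d \<le> m" and top: "\<And>i A. d < i \<Longrightarrow> i \<le> m \<Longrightarrow> trace A = 0 \<Longrightarrow> chi (monom A i) = 0"
    and e: "chi (monom e d) \<noteq> 0"
  shows "p ^ (d + 1) dvd V.dim (UNIV :: 'v set)"
proof -
  note b = basis[unfolded sl2_basis_def]
  have tr: "trace e = 0" "trace h = 0" and ee: "e ** e = 0" and he: "comm h e = mat_scale 2 e"
    using b by auto
  obtain B where B: "V.independent B" "UNIV \<subseteq> V.span B" "card B = V.dim (UNIV :: 'v set)"
    using V.basis_exists[of UNIV] by metis
  show ?thesis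
  proof (cases "finite B")
    case False
    \<comment> \<open>The dimension of a space with an infinite basis is \<open>0\<close> by convention.\<close>
    thus ?thesis using B(3) by simp
  next
    case True
    interpret V: finite_dimensional_vector_space sc B
      using True B by unfold_locales auto
    define E where "E i = rho (monom e i)" for i
    define wt where "wt i = chi (monom e i)" for i
    define H where "H i = rho (monom h i)" for i
    have eL: "monom e i \<in> cur_sl2 m" and hL: "monom h i \<in> cur_sl2 m" if "i \<le> d" for i
      using that d tr by (auto intro: monom_in_cur_sl2)
    have Elin: "Vector_Spaces.linear sc sc (E i)" if "i \<le> d" for i
      unfolding E_def by (rule rho_linear[OF eL[OF that]])
    have E_simps: "E i 0 = 0" "E i (v + w) = E i v + E i w" "E i (v - w) = E i v - E i w"
      "E i (sc c v) = sc c (E i v)" if "i \<le> d" for i v w c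
      using eL[OF that] by (simp_all add: E_def rho_zero_vec rho_add_vec rho_diff_vec rho_scale_vec)
    have H_simps: "H i 0 = 0" "H i (v - w) = H i v - H i w" "H i (sc c v) = sc c (H i v)" if "i \<le> d" for i v w c
      using hL[OF that] by (simp_all add: H_def rho_zero_vec rho_diff_vec rho_scale_vec)
    have EE: "E i (E j v) = E j (E i v)" if "i \<le> d" "j \<le> d" for i j v
    proof -
      have "comm e e = 0" by (simp add: comm_def)
      thus ?thesis using that d tr rho_monom_commute[of i j e e v] by (simp add: E_def rho_zero)
    qed
    have EH: "E i (H j v) = H j (E i v) + (if i + j \<le> d then sc (-2) (E (i + j) v) else 0)"
      if "i \<le> d" "j \<le> d" for i j v
    proof -
      have "comm e h = mat_scale (-1) (comm h e)" by (simp add: mat2_simps)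
      hence "comm e h = mat_scale (-2) e" by (simp add: he mat_scale_mat_scale)
      hence "rho (monom (comm e h) (i + j)) v = sc (-2) (E (i + j) v)" if "i + j \<le> m"
        using that tr rho_scale[of "monom e (i + j)" "-2" v]
        by (simp add: cur_scale_monom monom_in_cur_sl2 E_def)
      moreover have "E (i + j) v = 0" if "d < i + j" "i + j \<le> m"
        unfolding E_def by (rule rho_monom_eq_0_above[OF top that tr(1)])
      ultimately show ?thesis
        using that d tr rho_monom_commute[of i j e h v] by (auto simp: E_def H_def)
    qed
    have Epow: "(E i ^^ p) v = sc (wt i ^ p) v" if "i \<le> d" for i v
      using that d tr rho_monom_pow[of i e v] mat_pow_eq_0[OF ee] by (simp add: E_def wt_def rho_zero)
    define D where "D = (E d ^^ (p - 1))"
    have D: "D (E d v) = sc (wt d ^ p) v" for v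
    proof -
      have "D (E d v) = (E d ^^ Suc (p - 1)) v" by (simp only: D_def funpow_Suc_right o_apply)
      thus ?thesis using p_gt_2 Epow[of d] by simp
    qed
    have Dpow: "(E d ^^ n) 0 = 0" "(E d ^^ n) (v + w) = (E d ^^ n) v + (E d ^^ n) w"
      "(E d ^^ n) (sc c v) = sc c ((E d ^^ n) v)"
      "i \<le> d \<Longrightarrow> E i ((E d ^^ n) v) = (E d ^^ n) (E i v)" for n i v w c
      by (induction n) (simp_all add: E_simps EE)
    have D_simps: "D 0 = 0" "D (v + w) = D v + D w" "D (sc c v) = sc c (D v)"
      "i \<le> d \<Longrightarrow> E i (D v) = D (E i v)" for i v w c
      unfolding D_def by (rule Dpow, assumption?)+
    define X where "X i v = E (d - i) v - sc (wt (d - i)) v" for i v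
    define Y where "Y i v = D (H i v)" for i v
    have diff: "D (v - w) = D v - D w" for v w
      using D_simps(2)[of "v - w" w] by simp
    have comm: "X i (Y j v) = Y j (X i v) + (if j \<le> i then D (sc (-2) (E (d - i + j) v)) else 0)"
      if "i \<le> d" "j \<le> d" for i j v
      using that by (auto simp: X_def Y_def D_simps diff H_simps EH)
    have "V.dim (UNIV :: 'v set) = CHAR('k) ^ (d + 1) * V.dim {v. \<forall>i<d + 1. X i v = 0}"
    proof (rule V.dim_weyl_system[where X = X and Y = Y and c = "-2 * wt d ^ p"])
      fix i assume "i < d + 1"
      hence i: "i \<le> d" by simp
      show "Vector_Spaces.linear sc sc (X i)"
        unfolding X_def
        by unfold_locales (simp_all add: E_simps V.scale_right_distrib V.scale_right_diff_distrib mult.commute)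
      show "Y i 0 = 0" by (simp add: Y_def H_simps D_simps i)
      show "X i (Y i v) = Y i (X i v) + sc (-2 * wt d ^ p) v" for v
        using i by (simp add: comm D_simps D del: V.scale_minus_left)
      show "(X i ^^ CHAR('k)) v = 0" for v
        unfolding X_def
        by (rule V.funpow_minus_scale) (use Elin Epow prime_p p_char in auto)
    next
      fix i j v assume "i < j" "j < d + 1"
      thus "X i (Y j v) = Y j (X i v)" by (simp add: comm)
    next
      fix i j v assume "i < d + 1" "j < d + 1"
      thus "X i (X j v) = X j (X i v)"
        by (simp add: X_def E_simps EE[of "d - i"] V.scale_right_diff_distrib mult.commute algebra_simps)
    next
      show "-2 * wt d ^ p \<noteq> 0" using e two by (simp add: wt_def)
    qed
    thus ?thesis by (simp add: p_char)
  qed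
qed

end

theorem proposition5p4:
  fixes p m :: nat
    and chi :: "('k::alg_closed_field) mat2 poly \<Rightarrow> 'k"
    and act :: "('k mat2 poly list \<Rightarrow> 'k) set set \<Rightarrow> 'v::ab_group_add \<Rightarrow> 'v"
  assumes "CHAR('k) = p" and "p > 2" and "m > 0"
    and "chi \<in> lie_dual cur_scale (cur_sl2 m)"
    and "simple_module (sl2_red_env m p chi) act"
  shows "p ^ ((vector_space.dim cur_scale (cur_sl2 m :: 'k mat2 poly set)
               - vector_space.dim cur_scale (lie_stab (cur_bracket m) (cur_sl2 m) chi)) div 2)
         dvd sl2_module_dim m p chi act"
proof -
  have "prime p" using prime_CHAR_semidom[where ?'a = 'k] assms(1,2) by simp
  hence odd: "odd p" using assms(2) prime_odd_nat by blast
  have two: "(2 :: 'k) \<noteq> 0"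
  proof
    assume "(2 :: 'k) = 0"
    hence "of_nat 2 = (0 :: 'k)" by simp
    hence "p dvd 2" using assms(1) by (simp only: of_nat_eq_0_iff_char_dvd)
    thus False using assms(2) by (auto dest: dvd_imp_le)
  qed
  interpret lie_carrier cur_scale "cur_bracket m" "cur_sl2 m :: 'k mat2 poly set"
    by (rule lie_carrier_cur_sl2)
  have "left_module (red_env_alg cur_scale (cur_bracket m) (cur_sl2 m) p (cur_pmap m p) chi) act"
    using assms(5) by (simp add: simple_module_def sl2_red_env_def)
  hence "red_env_module cur_scale (cur_bracket m) (cur_sl2 m) p (cur_pmap m p) chi act"
    by (intro red_env_module.intro lie_carrier_cur_sl2 red_env_module_axioms.intro
        cur_pmap_closed[OF two odd])
  then interpret current_sl2_module m p chi act
    by (intro current_sl2_module.intro current_form.intro current_sl2_module_axioms.intro)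
      (use assms two in auto)
  have dim: "sl2_module_dim m p chi act = V.dim (UNIV :: 'v set)"
    by (simp add: sl2_module_dim_def sl2_red_const_def sc_def[abs_def])
  define S where "S = {i. i \<le> m \<and> (\<exists>A. trace A = 0 \<and> chi (monom A i) \<noteq> 0)}"
  show ?thesis
  proof (cases "S = {}")
    case True
    have "chi u = 0" if u: "u \<in> cur_sl2 m" for u
    proof -
      have tr: "trace (coeff u i) = 0" for i using u by (simp add: cur_sl2_def)
      have "chi u = chi (\<Sum>i\<le>m. monom (coeff u i) i)"
        using cur_sl2_sum_monom[OF u] by simp
      also have "\<dots> = (\<Sum>i\<le>m. chi (monom (coeff u i) i))"
        by (intro chi_sum monom_in_cur_sl2 tr) simp
      also have "\<dots> = 0" using True tr by (intro sum.neutral) (auto simp: S_def)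
      finally show ?thesis .
    qed
    hence "lie_stab (cur_bracket m) (cur_sl2 m) chi = cur_sl2 m"
      using br_closed by (auto simp: lie_stab_def)
    thus ?thesis by simp
  next
    case False
    have fin: "finite S" by (rule finite_subset[of _ "{..m}"]) (auto simp: S_def)
    define d where "d = Max S"
    have "d \<in> S" using Max_in[OF fin False] by (simp add: d_def)
    then obtain x where d: "d \<le> m" and x: "trace x = 0" "chi (monom x d) \<noteq> 0"
      by (auto simp: S_def)
    have top: "chi (monom A i) = 0" if "d < i" "i \<le> m" "trace A = 0" for i A
    proof (rule ccontr)
      assume "chi (monom A i) \<noteq> 0"
      hence "i \<in> S" using that by (auto simp: S_def)
      thus False using Max_ge[OF fin] that by (fastforce simp: d_def)
    qed
    obtain \<kappa> e h f where basis: "sl2_basis \<kappa> e h f" and e: "chi (monom e d) \<noteq> 0"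
      by (rule obtain_sl2_basis[of "\<lambda>A. chi (monom A d)" x])
        (use two x d in \<open>simp_all add: chi_monom_add chi_monom_scale\<close>)
    have "p ^ (d + 1) dvd V.dim (UNIV :: 'v set)"
      by (rule power_dvd_dim[OF basis d top e])
    moreover have "vector_space.dim cur_scale (cur_sl2 m :: 'k mat2 poly set)
        - vector_space.dim cur_scale (lie_stab (cur_bracket m) (cur_sl2 m) chi) \<le> 2 * (d + 1)"
      by (rule codim_lie_stab_le[OF basis d top e])
    from div_le_mono[OF this, of 2]
    have "(vector_space.dim cur_scale (cur_sl2 m :: 'k mat2 poly set)
        - vector_space.dim cur_scale (lie_stab (cur_bracket m) (cur_sl2 m) chi)) div 2 \<le> d + 1"
      by simp
    ultimately show ?thesis
      unfolding dim by (meson dvd_trans le_imp_power_dvd)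
  qed
qed

end
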